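(* Let $n\ge 1$, let $k_1,\dots,k_n\ge 0$ be integers and let $f_1,\dots,f_n$ be modular cusp forms of level $1$ and weights $k_1,\dots,k_n$ respectively, with rational Fourier coefficients. Let $(m_1,\dots,m_n)\in\mathbb Z_{>0}^n$ satisfy $$m_n>\tfrac{k_n}{2}+1,\quad m_{n-1}+m_n>\tfrac{k_{n-1}}2+\tfrac{k_n}{2}+2,\ \dots,\quad m_1+\dots+m_n>\tfrac{k_1}{2}+\dots+\tfrac{k_n}{2}+n,$$ i.e. $m_j+\dots+m_n>\frac{k_j+\dots+k_n}{2}+(n-j+1)$ for every $1\le j\le n$. For integers $M_1,\dots,M_n$ put $$A_{m_1,\dots,m_n}(M_1,\dots,M_n)=\sum_{(\alpha_{a,b})}\frac{(m_1-1)!\cdots(m_n-1)!}{\prod_{1\le a\le b\le n}\alpha_{a,b}!},$$ the sum being over families $(\alpha_{a,b})_{1\le a\le b\le n}$ of non-negative integers with $\sum_{a=1}^{b}\alpha_{a,b}=m_b-1$ for all $b$ and $\sum_{b=j}^n\alpha_{j,b}=M_j-1$ for all $j$, and $$B_{m_1,\dots,m_n}(M_1,\dots,M_n)=(-1)^{\sum_{j=1}^n(n+1-j)(M_j-m_j)}\prod_{j=1}^{n-1}\binom{m_{j+1}-1}{\sum_{a=1}^j(M_a-m_a)}.$$ Then $$\Lambda(f_1,\dots,f_n;m_1,\dots,m_n)=\sum_{\substack{M_1,\dots,M_n\ge 1\\ \sum M_j=\sum m_j}}A_{m_1,\dots,m_n}(M_1,\dots,M_n)\,L^*(f_1,\dots,f_n;M_1,\dots,M_n),$$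 $$L^*(f_1,\dots,f_n;m_1,\dots,m_n)=\sum_{\substack{M_1,\dots,M_n\ge 1\\ \sum M_j=\sum m_j}}B_{m_1,\dots,m_n}(M_1,\dots,M_n)\,\Lambda(f_1,\dots,f_n;M_1,\dots,M_n).$$ The last relation allows one to extend the definition of $L^*$ to every $n$-tuple of natural integers.
   Context: Write $f_j(z)=\sum_{l>0}a_l(f_j)e^{2i\pi lz}$ for the Fourier expansion of the cusp form $f_j$ of weight $k_j$ for $SL_2(\mathbb Z)$. For complex variables with $\mathrm{Re}(s_n)>k_n/2+1,\dots,\mathrm{Re}(s_1+\dots+s_n)>k_1/2+\dots+k_n/2+n$ define $$L(f_1,\dots,f_n;s_1,\dots,s_n)=\sum_{l_1,\dots,l_n>0}\frac{a_{l_1}(f_1)\cdots a_{l_n}(f_n)}{(l_1+\dots+l_n)^{s_1}(l_2+\dots+l_n)^{s_2}\cdots l_n^{s_n}},$$ $$L^*(f_1,\dots,f_n;s_1,\dots,s_n)=\frac{\Gamma(s_1)\cdots\Gamma(s_n)}{(2\pi)^{s_1+\dots+s_n}}L(f_1,\dots,f_n;s_1,\dots,s_n),$$ $$\Lambda(f_1,\dots,f_n;s_1,\dots,s_n)=\int_{0<t_1<\dots<t_n}f_1(it_1)t_1^{s_1-1}\cdots f_n(it_n)t_n^{s_n-1}\,dt_1\cdots dt_n.$$ The function $\Lambda$ extends holomorphically to $\mathbb C^n$, and $\Lambda$ also denotes this extension. Binomial coefficients $\binom Nr$ are $0$ unless $0\le r\le N$.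
   Formalization: The series defining L need not converge in the stated region (e.g. n=2, f_1=f_2=Δ, m=(1,14)), nor at every M in the first relation; where it does not converge absolutely, L is taken as its entire analytic continuation in s_1. *)

theory Defs
  imports "HOL-Complex_Analysis.Complex_Analysis"
begin

text \<open>
  Families indexed by \<open>1, \<dots>, n\<close> (forms, weights, exponents) are functions on \<open>nat\<close> of which only
  the values on \<open>{1..n}\<close> matter.
\<close>

definition has_cusp_expansion :: "(complex \<Rightarrow> complex) \<Rightarrow> (nat \<Rightarrow> complex) \<Rightarrow> bool" where
  "has_cusp_expansion f a \<longleftrightarrow> a 0 = 0 \<and>
     (\<forall>z. Im z > 0 \<longrightarrow>
        ((\<lambda>l. a l * exp (2 * \<i> * of_real pi * of_nat l * z)) has_sum f z) {0<..})"

definition cusp_form :: "nat \<Rightarrow> (complex \<Rightarrow> complex) \<Rightarrow> bool" where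
  "cusp_form k f \<longleftrightarrow>
     f holomorphic_on {z. Im z > 0} \<and>
     (\<forall>a b c d :: int. a * d - b * c = 1 \<longrightarrow>
        (\<forall>z. Im z > 0 \<longrightarrow>
           f ((of_int a * z + of_int b) / (of_int c * z + of_int d))
             = (of_int c * z + of_int d) ^ k * f z)) \<and>
     (\<exists>a. has_cusp_expansion f a)"

definition fourier_coeff :: "(complex \<Rightarrow> complex) \<Rightarrow> nat \<Rightarrow> complex" where
  "fourier_coeff f = (THE a. has_cusp_expansion f a)"

definition mL_indices :: "nat \<Rightarrow> (nat \<Rightarrow> nat) set" where
  "mL_indices n = PiE {1..n} (\<lambda>_. {0<..})"

definition mL_term ::
    "nat \<Rightarrow> (nat \<Rightarrow> complex \<Rightarrow> complex) \<Rightarrow> (nat \<Rightarrow> complex) \<Rightarrow> (nat \<Rightarrow> nat) \<Rightarrow> complex" where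
  "mL_term n f s l =
     (\<Prod>j=1..n. fourier_coeff (f j) (l j)) /
     (\<Prod>j=1..n. of_nat (\<Sum>i=j..n. l i) powr s j)"

text \<open>
  The sum of the Dirichlet series wherever it converges absolutely (for complex terms
  \<open>summable_on\<close> is absolute summability).  Some points of the region
  \<open>Re (s\<^sub>j + \<dots> + s\<^sub>n) > (k\<^sub>j + \<dots> + k\<^sub>n) / 2 + (n - j + 1)\<close> are not points of convergence: the sum
  over \<open>l\<^sub>1\<close> alone requires \<open>s\<^sub>1\<close> to be large, which the region does not provide.  There, the
  value is that of the analytic continuation in \<open>s\<^sub>1\<close>: for fixed \<open>s\<^sub>2, \<dots>, s\<^sub>n\<close> the series is an
  ordinary Dirichlet series in \<open>s\<^sub>1\<close> (in powers of \<open>l\<^sub>1 + \<dots> + l\<^sub>n\<close>), absolutely convergent on some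
  right half-plane, and its sum extends to an entire function, necessarily unique.
\<close>

definition mL :: "nat \<Rightarrow> (nat \<Rightarrow> complex \<Rightarrow> complex) \<Rightarrow> (nat \<Rightarrow> complex) \<Rightarrow> complex" where
  "mL n f s =
     (if mL_term n f s summable_on mL_indices n
      then (\<Sum>\<^sub>\<infinity>l\<in>mL_indices n. mL_term n f s l)
      else (THE g. g holomorphic_on UNIV \<and>
              (\<exists>\<sigma>::real. \<forall>z. Re z > \<sigma> \<longrightarrow>
                 (mL_term n f (s(1 := z)) has_sum g z) (mL_indices n))) (s 1))"

definition mLstar :: "nat \<Rightarrow> (nat \<Rightarrow> complex \<Rightarrow> complex) \<Rightarrow> (nat \<Rightarrow> complex) \<Rightarrow> complex" where
  "mLstar n f s =
     (\<Prod>j=1..n. Gamma (s j)) / of_real (2 * pi) powr (\<Sum>j=1..n. s j) * mL n f s"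

definition ordered_region :: "nat \<Rightarrow> (nat \<Rightarrow> real) set" where
  "ordered_region n = {t \<in> PiE {1..n} (\<lambda>_. {0<..}). strict_mono_on {1..n} t}"

definition mLambda_integrand ::
    "nat \<Rightarrow> (nat \<Rightarrow> complex \<Rightarrow> complex) \<Rightarrow> (nat \<Rightarrow> complex) \<Rightarrow> (nat \<Rightarrow> real) \<Rightarrow> complex" where
  "mLambda_integrand n f s t =
     (\<Prod>j=1..n. f j (\<i> * of_real (t j)) * of_real (t j) powr (s j - 1))"

text \<open>
  Cusp forms of level one decay rapidly along the imaginary axis both at \<open>0\<close> and at \<open>\<infinity>\<close>, so the
  integral converges absolutely for every \<open>s\<close>; it is therefore itself the holomorphic extension
  to \<open>\<complex>\<^sup>n\<close>.
\<close>

definition mLambda :: "nat \<Rightarrow> (nat \<Rightarrow> complex \<Rightarrow> complex) \<Rightarrow> (nat \<Rightarrow> complex) \<Rightarrow> complex" where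
  "mLambda n f s =
     set_lebesgue_integral (Pi\<^sub>M {1..n} (\<lambda>_. lborel)) (ordered_region n) (mLambda_integrand n f s)"

text \<open>The equations are written without the subtractions in \<open>m\<^sub>b - 1\<close> and \<open>M\<^sub>j - 1\<close>, which
  would truncate on \<open>nat\<close>.\<close>

definition alpha_families ::
    "nat \<Rightarrow> (nat \<Rightarrow> nat) \<Rightarrow> (nat \<Rightarrow> nat) \<Rightarrow> (nat \<times> nat \<Rightarrow> nat) set" where
  "alpha_families n m M =
     {\<alpha> \<in> PiE {(a, b). 1 \<le> a \<and> a \<le> b \<and> b \<le> n} (\<lambda>_. UNIV).
        (\<forall>b\<in>{1..n}. (\<Sum>a=1..b. \<alpha> (a, b)) + 1 = m b) \<and>
        (\<forall>j\<in>{1..n}. (\<Sum>b=j..n. \<alpha> (j, b)) + 1 = M j)}"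

definition coeff_A :: "nat \<Rightarrow> (nat \<Rightarrow> nat) \<Rightarrow> (nat \<Rightarrow> nat) \<Rightarrow> complex" where
  "coeff_A n m M =
     (\<Sum>\<alpha>\<in>alpha_families n m M.
        (\<Prod>j=1..n. fact (m j - 1)) /
        (\<Prod>p\<in>{(a, b). 1 \<le> a \<and> a \<le> b \<and> b \<le> n}. fact (\<alpha> p)))"

definition int_binom :: "int \<Rightarrow> int \<Rightarrow> nat" where
  "int_binom N r = (if 0 \<le> r \<and> r \<le> N then nat N choose nat r else 0)"

definition coeff_B :: "nat \<Rightarrow> (nat \<Rightarrow> nat) \<Rightarrow> (nat \<Rightarrow> nat) \<Rightarrow> complex" where
  "coeff_B n m M =
     (-1) powi (\<Sum>j=1..n. (int n + 1 - int j) * (int (M j) - int (m j))) *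
     (\<Prod>j=1..n-1. of_nat (int_binom (int (m (j + 1)) - 1) (\<Sum>a=1..j. int (M a) - int (m a))))"

definition tuples_same_sum :: "nat \<Rightarrow> (nat \<Rightarrow> nat) \<Rightarrow> (nat \<Rightarrow> nat) set" where
  "tuples_same_sum n m =
     {M \<in> PiE {1..n} (\<lambda>_. {1..}). (\<Sum>j=1..n. M j) = (\<Sum>j=1..n. m j)}"

definition admissible :: "nat \<Rightarrow> (nat \<Rightarrow> nat) \<Rightarrow> (nat \<Rightarrow> nat) \<Rightarrow> bool" where
  "admissible n k m \<longleftrightarrow>
     (\<forall>j\<in>{1..n}. m j > 0) \<and>
     (\<forall>j\<in>{1..n}. real (\<Sum>i=j..n. m i) > real (\<Sum>i=j..n. k i) / 2 + real (n - j + 1))"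

end

theory Submission
  imports Defs
begin

text \<open>
  Writing each factor \<open>\<Gamma> (s\<^sub>j) / (2 * \<pi> * (l\<^sub>j + \<dots> + l\<^sub>n))\<^bsup>s j\<^esup>\<close> as a Gamma integral in a variable \<open>u\<^sub>j\<close> and
  putting \<open>t\<^sub>j = u\<^sub>1 + \<dots> + u\<^sub>j\<close> turns \<open>L\<^sup>*\<close> into the integral of
  \<open>f\<^sub>1 (\<i> t\<^sub>1) \<dots> f\<^sub>n (\<i> t\<^sub>n) * (t\<^sub>1 - t\<^sub>0)\<^bsup>s 1 - 1\<^esup> \<dots> (t\<^sub>n - t\<^sub>n\<^sub>-\<^sub>1)\<^bsup>s n - 1\<^esup>\<close> over \<open>0 < t\<^sub>1 < \<dots> < t\<^sub>n\<close>, with \<open>t\<^sub>0 = 0\<close>.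
  This holds where the series converges absolutely, and elsewhere by continuation in \<open>s\<^sub>1\<close>.
  For positive integer exponents, both relations are then polynomial identities under the
  integral sign: the \<open>t\<^sub>j\<close> are sums of the gaps \<open>t\<^sub>a - t\<^sub>a\<^sub>-\<^sub>1\<close> (multinomial theorem, coefficients \<open>A\<close>),
  and the gaps are differences of the \<open>t\<^sub>j\<close> (binomial theorem, coefficients \<open>B\<close>).
\<close>

section \<open>Cusp forms of level one\<close>

text \<open>The sums over \<open>M\<close> run through every positive tuple with the given total,
  and such a tuple may lie where the Dirichlet series diverges. The integral formula for
  \<open>mLstar\<close> is therefore needed at all positive integer tuples, and this is what makes
  continuation in \<open>s 1\<close> unavoidable. The variable \<open>s 1\<close> is special because
  the first gap is \<open>t 1\<close> itself: \<open>f 1\<close> decays faster than every power at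
  0, so any complex exponent is harmless there and the integral is entire in \<open>s 1\<close>. A
  later gap can vanish at points where no form is small, and \<open>Re (s j) \<ge> 1\<close> keeps
  its power bounded near them. Continuation may start from any right half-plane of absolute
  convergence, so a polynomial bound on the Fourier coefficients suffices. The exponent
  \<open>k\<close> obtained below from a crude growth estimate takes the place of the sharper
  \<open>k / 2\<close>.\<close>

lemma cusp_expansion_has_sum:
  assumes "has_cusp_expansion f a" "Im z > 0"
  shows "((\<lambda>l. a l * exp (2 * \<i> * of_real pi * z) ^ l) has_sum f z) UNIV"
proof -
  have "((\<lambda>l. a l * exp (2 * \<i> * of_real pi * of_nat l * z)) has_sum f z) {0<..}"
    using assms by (auto simp: has_cusp_expansion_def)
  also have "?this \<longleftrightarrow> ?thesis"
    using assms(1)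
    by (intro has_sum_cong_neutral)
       (auto simp: has_cusp_expansion_def mult_ac simp flip: exp_of_nat_mult)
  finally show ?thesis .
qed

text \<open>The principal logarithm picks one \<open>z\<close> with
  \<open>exp (2 * \<i> * pi * z) = q\<close>, and the expansion at that \<open>z\<close> is a power
  series in \<open>q\<close>. The choice of branch is immaterial because the sum depends on
  \<open>q\<close> only.\<close>

lemma cusp_expansion_powser:
  assumes "has_cusp_expansion f a" "norm q < 1"
  shows "(\<lambda>l. a l * q ^ l) sums (if q = 0 then 0 else f (Ln q / (2 * \<i> * of_real pi)))"
proof (cases "q = 0")
  case True
  thus ?thesis using assms(1) by (simp add: has_cusp_expansion_def)
next
  case False
  have "Im (Ln q / (2 * \<i> * of_real pi)) = - ln (norm q) / (2 * pi)"
    using False by (simp add: Im_divide power2_eq_square field_simps)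
  hence "Im (Ln q / (2 * \<i> * of_real pi)) > 0"
    using False assms(2) by (simp add: divide_neg_pos)
  from has_sum_imp_sums[OF cusp_expansion_has_sum[OF assms(1) this]] show ?thesis
    using False by (simp add: exp_Ln)
qed

lemma has_fps_expansion_cusp:
  assumes "has_cusp_expansion f a"
  shows "(\<lambda>q. if q = 0 then 0 else f (Ln q / (2 * \<i> * of_real pi))) has_fps_expansion Abs_fps a"
proof (rule has_fps_expansionI)
  have "eventually (\<lambda>q. q \<in> ball 0 (1::real)) (nhds (0::complex))"
    by (intro eventually_nhds_in_open) auto
  thus "eventually (\<lambda>u. (\<lambda>n. fps_nth (Abs_fps a) n * u ^ n) sums
          (if u = 0 then 0 else f (Ln u / (2 * \<i> * of_real pi)))) (nhds 0)"
    by eventually_elim (use cusp_expansion_powser[OF assms] in simp)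
qed

text \<open>This discharges the definite description in \<open>fourier_coeff\<close>: two expansions
  of \<open>f\<close> are power series of the same function of \<open>q\<close> near 0, so their
  coefficients agree.\<close>

lemma fourier_coeff_eqI:
  assumes "has_cusp_expansion f a"
  shows "fourier_coeff f = a"
  unfolding fourier_coeff_def
proof (rule the_equality)
  fix b assume "has_cusp_expansion f b"
  hence "Abs_fps b = Abs_fps a"
    by (meson assms fps_expansion_unique_complex has_fps_expansion_cusp)
  thus "b = a" by (metis fps_nth_Abs_fps ext)
qed fact

lemma cusp_form_expansion:
  assumes "cusp_form k f"
  shows "has_cusp_expansion f (fourier_coeff f)"
proof -
  obtain a where "has_cusp_expansion f a" using assms unfolding cusp_form_def by blast
  thus ?thesis by (simp add: fourier_coeff_eqI)
qed

section \<open>Decay and growth of cusp forms in the upper half-plane, and the size of their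
  coefficients\<close>

lemma cusp_expansion_abs_summable:
  assumes "has_cusp_expansion f a" "y > 0"
  shows "(\<lambda>l. norm (a l) * exp (- 2 * pi * y) ^ l) summable_on UNIV"
proof -
  have "(\<lambda>l. norm (a l * exp (2 * \<i> * of_real pi * (\<i> * of_real y)) ^ l)) summable_on UNIV"
    using cusp_expansion_has_sum[OF assms(1), of "\<i> * of_real y"] assms(2)
    by (subst summable_on_iff_abs_summable_on_complex [symmetric]) (auto simp: has_sum_imp_summable)
  thus ?thesis by (simp add: norm_mult norm_power)
qed

text \<open>Since \<open>a 0 = 0\<close>, only terms with \<open>l \<ge> 1\<close> remain. Raising
  the height from \<open>c\<close> to \<open>Im z\<close> multiplies the modulus of such a term by
  \<open>e ^ l \<le> e\<close>, where \<open>e = exp (- 2 * pi * (Im z - c))\<close>.\<close>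

lemma cusp_expansion_decay:
  assumes "has_cusp_expansion f a" "c > 0"
  obtains C where "C \<ge> 0" "\<And>z. Im z \<ge> c \<Longrightarrow> norm (f z) \<le> C * exp (- 2 * pi * Im z)"
proof -
  define S where "S = (\<Sum>\<^sub>\<infinity>l. norm (a l) * exp (- 2 * pi * c) ^ l)"
  have S: "S \<ge> 0" unfolding S_def by (intro infsum_nonneg) auto
  have "norm (f z) \<le> (S * exp (2 * pi * c)) * exp (- 2 * pi * Im z)" if z: "Im z \<ge> c" for z
  proof -
    define e where "e = exp (- 2 * pi * (Im z - c))"
    have e: "0 < e" "e \<le> 1" using z by (auto simp: e_def)
    have "Im z > 0" using z assms(2) by auto
    note hs = cusp_expansion_has_sum[OF assms(1) this]
    have sm: "(\<lambda>l. norm (a l * exp (2 * \<i> * of_real pi * z) ^ l)) summable_on UNIV"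
      using has_sum_imp_summable[OF hs] by (simp only: summable_on_iff_abs_summable_on_complex)
    have ne: "norm (a l * exp (2 * \<i> * of_real pi * z) ^ l) = norm (a l) * exp (- 2 * pi * Im z) ^ l" for l
      by (simp add: norm_mult norm_power)
    have le: "norm (a l) * exp (- 2 * pi * Im z) ^ l \<le> e * (norm (a l) * exp (- 2 * pi * c) ^ l)" for l
    proof (cases "l = 0")
      case True
      thus ?thesis using assms(1) by (simp add: has_cusp_expansion_def)
    next
      case False
      have "exp (- 2 * pi * Im z) = e * exp (- 2 * pi * c)"
        unfolding e_def exp_add [symmetric] by (simp add: algebra_simps)
      hence "exp (- 2 * pi * Im z) ^ l = e ^ l * exp (- 2 * pi * c) ^ l"
        by (simp add: power_mult_distrib)
      also have "\<dots> \<le> e * exp (- 2 * pi * c) ^ l"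
        using power_decreasing[of 1 l e] e False by (intro mult_right_mono) auto
      finally have "norm (a l) * exp (- 2 * pi * Im z) ^ l \<le> norm (a l) * (e * exp (- 2 * pi * c) ^ l)"
        by (rule mult_left_mono) simp
      thus ?thesis by (simp only: mult.left_commute)
    qed
    have "norm (f z) \<le> (\<Sum>\<^sub>\<infinity>l. norm (a l * exp (2 * \<i> * of_real pi * z) ^ l))"
      using norm_infsum_bound[OF sm] by (simp only: infsumI[OF hs])
    also have "\<dots> \<le> (\<Sum>\<^sub>\<infinity>l. e * (norm (a l) * exp (- 2 * pi * c) ^ l))"
    proof (rule infsum_mono)
      show "(\<lambda>l. e * (norm (a l) * exp (- 2 * pi * c) ^ l)) summable_on UNIV"
        by (intro summable_on_cmult_right cusp_expansion_abs_summable[OF assms])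
    qed (use sm le in \<open>simp_all only: ne\<close>)
    also have "\<dots> = e * S" unfolding S_def
      by (intro infsum_cmult_right cusp_expansion_abs_summable[OF assms])
    also have "e = exp (2 * pi * c) * exp (- 2 * pi * Im z)"
      unfolding e_def exp_add [symmetric] by (simp add: algebra_simps)
    finally show ?thesis by (simp add: mult_ac)
  qed
  with S show ?thesis by (intro that[of "S * exp (2 * pi * c)"]) auto
qed

text \<open>Dirichlet approximation replaces reduction to a fundamental domain. With
  \<open>y = Im z\<close> and \<open>N\<close> about \<open>1 / sqrt y\<close>, a fraction
  \<open>h / c\<close> with \<open>c \<le> N\<close> approximates \<open>Re z\<close> so well that
  \<open>w = c * z - h\<close> has squared real part at most \<open>y\<close> and squared imaginary
  part at most \<open>4 * y\<close>. A matrix with bottom row \<open>(c, - h)\<close> thus lifts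
  \<open>z\<close> to height \<open>y / norm w ^ 2 \<ge> 1/5\<close>, where \<open>f\<close> is
  bounded. Weight \<open>k\<close> modularity and \<open>norm w \<ge> y\<close> carry the bound back
  to \<open>z\<close>.\<close>

lemma cusp_form_growth:
  assumes "cusp_form k f"
  obtains C where "C \<ge> 0" "\<And>z. 0 < Im z \<Longrightarrow> Im z \<le> 1 \<Longrightarrow> norm (f z) \<le> C / Im z ^ k"
proof -
  obtain C where C: "C \<ge> 0" "\<And>z. Im z \<ge> 1/5 \<Longrightarrow> norm (f z) \<le> C * exp (- 2 * pi * Im z)"
    using cusp_expansion_decay[OF cusp_form_expansion[OF assms], of "1/5"] by auto
  have bd: "norm (f z) \<le> C" if "Im z \<ge> 1/5" for z
  proof -
    have "C * exp (- 2 * pi * Im z) \<le> C * 1" using that C(1) by (intro mult_left_mono) auto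
    with C(2)[OF that] show ?thesis by simp
  qed
  have "norm (f z) \<le> C / Im z ^ k" if z: "0 < Im z" "Im z \<le> 1" for z
  proof -
    define y where "y = Im z"
    have y: "0 < y" "y \<le> 1" using z by (auto simp: y_def)
    define N where "N = nat \<lceil>1 / sqrt y\<rceil>"
    have N: "real N \<ge> 1 / sqrt y" "real N \<le> 1 / sqrt y + 1" "N > 0"
      using y unfolding N_def by (auto simp: of_nat_ceiling)
    obtain h c where hc: "coprime h c" "0 < c" "c \<le> int N" "\<bar>of_int c * Re z - of_int h\<bar> < 1/N"
      using Dirichlet_approx_coprime[OF N(3)] by blast
    \<comment> \<open>The pair \<open>(c, d)\<close> becomes the bottom row of an integer matrix of
      determinant 1; Bezout coefficients supply the top row \<open>(u, - v)\<close>.\<close>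
    define d where "d = - h"
    have "coprime d c" using hc(1) by (simp add: d_def)
    then obtain u v where uv: "u * d + v * c = 1"
      using bezout_int[of d c] by auto
    define w where "w = of_int c * z + of_int d"
    have w: "Re w = of_int c * Re z - of_int h" "Im w = of_int c * y"
      by (auto simp: w_def d_def y_def)
    have "w \<noteq> 0" using w y hc by (auto simp: complex_eq_iff)
    have "norm w \<ge> y"
    proof -
      have "norm w \<ge> \<bar>Im w\<bar>" by (rule abs_Im_le_cmod)
      moreover have "\<bar>Im w\<bar> \<ge> 1 * y" unfolding w using y hc(2) by (simp add: abs_mult)
      ultimately show ?thesis by simp
    qed
    have "norm w ^ 2 \<le> 5 * y"
    proof -
      have "(Re w)\<^sup>2 \<le> (1 / real N)\<^sup>2"
        using hc(4) N(3) unfolding w by (intro power2_le_iff_abs_le[THEN iffD2]) auto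
      also have "\<dots> \<le> (sqrt y)\<^sup>2"
        using N y by (intro power_mono) (auto simp: field_simps)
      finally have 1: "(Re w)\<^sup>2 \<le> y" using y by simp
      have "\<bar>Im w\<bar> \<le> real N * y"
        unfolding w using hc y by (simp add: abs_mult mult_right_mono)
      also have "\<dots> \<le> (1 / sqrt y + 1) * y" using N y by (intro mult_right_mono) auto
      also have "\<dots> = sqrt y * (1 + sqrt y)"
        using y by (simp add: field_simps)
      also have "\<dots> \<le> sqrt y * 2" using y by (intro mult_left_mono) auto
      finally have "(Im w)\<^sup>2 \<le> (sqrt y * 2)\<^sup>2"
        using y by (intro power2_le_iff_abs_le[THEN iffD2]) auto
      hence 2: "(Im w)\<^sup>2 \<le> 4 * y" using y by (simp add: power_mult_distrib)
      show ?thesis using 1 2 by (simp add: cmod_power2)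
    qed
    define z' where "z' = (of_int u * z + of_int (- v)) / w"
    have "f z' = w ^ k * f z"
    proof -
      have "u * d - (- v) * c = 1" using uv by simp
      with assms z(1) show ?thesis unfolding cusp_form_def z'_def w_def by blast
    qed
    have "Im z' = y / norm w ^ 2"
    proof -
      have "of_int u * of_int d + of_int v * of_int c = (1::real)"
        using uv by (metis of_int_1 of_int_add of_int_mult)
      hence "Im (of_int u * z + of_int (- v)) * Re w - Re (of_int u * z + of_int (- v)) * Im w = y"
        by (simp add: w_def y_def) algebra
      thus ?thesis by (simp add: z'_def Im_divide cmod_power2)
    qed
    hence "Im z' \<ge> 1/5" using \<open>norm w ^ 2 \<le> 5 * y\<close> \<open>w \<noteq> 0\<close> by (simp add: pos_le_divide_eq)
    hence "norm (f z') \<le> C" by (rule bd)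
    hence "norm w ^ k * norm (f z) \<le> C" by (simp add: \<open>f z' = _\<close> norm_mult norm_power)
    moreover have "y ^ k * norm (f z) \<le> norm w ^ k * norm (f z)"
      using y \<open>norm w \<ge> y\<close> by (intro mult_right_mono power_mono) auto
    ultimately have "y ^ k * norm (f z) \<le> C" by linarith
    thus ?thesis using y by (simp add: y_def field_simps)
  qed
  with C(1) show ?thesis by (rule that)
qed

text \<open>Cauchy's inequality on the circle \<open>norm q = exp (- 2 * pi / l)\<close>.\<close>

lemma cusp_form_fourier_coeff_bound:
  assumes "cusp_form k f"
  obtains C where "C \<ge> 0" "\<And>l. l > 0 \<Longrightarrow> norm (fourier_coeff f l) \<le> C * real l ^ k"
proof -
  obtain C where C: "C \<ge> 0" "\<And>z. 0 < Im z \<Longrightarrow> Im z \<le> 1 \<Longrightarrow> norm (f z) \<le> C / Im z ^ k"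
    using cusp_form_growth[OF assms] by blast
  define a where "a = fourier_coeff f"
  have exp: "has_cusp_expansion f a" unfolding a_def by (rule cusp_form_expansion[OF assms])
  define F where "F = (\<lambda>q. if q = 0 then 0 else f (Ln q / (2 * \<i> * of_real pi)))"
  have Fs: "(\<lambda>l. a l * (q - 0) ^ l) sums F q" if "q \<in> ball 0 1" for q
    using cusp_expansion_powser[OF exp, of q] that by (simp add: F_def)
  have hol: "F holomorphic_on ball 0 1" by (rule power_series_holomorphic[OF Fs])
  have coeff: "a l = (deriv ^^ l) F 0 / fact l" for l
    using fps_nth_fps_expansion[of F "Abs_fps a" l] has_fps_expansion_cusp[OF exp]
    by (simp add: F_def)
  have "norm (a l) \<le> (exp (2 * pi) * C) * real l ^ k" if l: "l > 0" for l
  proof -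
    \<comment> \<open>Points on this circle come from height \<open>1 / l\<close>, where the growth
      bound reads \<open>C * l ^ k\<close>. Moreover \<open>r ^ l = exp (- 2 * pi)\<close> does not
      depend on \<open>l\<close>, which explains the factor \<open>exp (2 * pi)\<close> in the
      constant.\<close>
    define r where "r = exp (- 2 * pi / real l)"
    have r: "0 < r" "r < 1" using l by (auto simp: r_def)
    have "norm ((deriv ^^ l) F 0) \<le> fact l * (C * real l ^ k) / r ^ l"
    proof (rule Cauchy_inequality)
      show "F holomorphic_on ball 0 r" using r by (intro holomorphic_on_subset[OF hol]) auto
      show "continuous_on (cball 0 r) F"
        using r by (intro holomorphic_on_imp_continuous_on holomorphic_on_subset[OF hol]) auto
      fix q :: complex assume q: "norm (0 - q) = r"
      hence q0: "q \<noteq> 0" using r by auto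
      have "Im (Ln q / (2 * \<i> * of_real pi)) = - ln (norm q) / (2 * pi)"
        using q0 by (simp add: Im_divide power2_eq_square field_simps)
      also have "\<dots> = 1 / real l" using q l by (simp add: r_def)
      finally have "norm (f (Ln q / (2 * \<i> * of_real pi))) \<le> C / (1 / real l) ^ k"
        using l C(2)[of "Ln q / (2 * \<i> * of_real pi)"] by simp
      thus "norm (F q) \<le> C * real l ^ k" using q0 l by (simp add: F_def power_divide)
    qed (use r in auto)
    moreover have "r ^ l = exp (- 2 * pi)"
      using l by (simp add: r_def flip: exp_of_nat_mult)
    ultimately show ?thesis
      by (simp add: coeff norm_divide exp_minus field_simps)
  qed
  thus ?thesis using C(1) that[of "exp (2 * pi) * C"] by (simp add: a_def)
qed

text \<open>As \<open>2 * pi > 2\<close>, the exponential supplies two factors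
  \<open>exp (- t)\<close>: one absorbs the power through \<open>t ^ n \<le> fact n * exp t\<close>,
  the other survives. For negative \<open>r\<close> the choice of \<open>n\<close> is 0.\<close>

lemma powr_times_exp_bounded:
  fixes r :: real
  obtains B where "B \<ge> 0" "\<And>t. t \<ge> 1 \<Longrightarrow> t powr r * exp (- 2 * pi * t) \<le> B * exp (- t)"
proof -
  define n where "n = nat \<lceil>r\<rceil>"
  have "t powr r * exp (- 2 * pi * t) \<le> fact n * exp (- t)" if t: "t \<ge> 1" for t :: real
  proof -
    have "t powr r \<le> t powr real n" unfolding n_def using t by (intro powr_mono) linarith+
    also have "\<dots> = t ^ n" using t by (simp add: powr_realpow)
    also have "t ^ n \<le> fact n * exp t"
    proof -
      have "t ^ n /\<^sub>R fact n \<le> exp t"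
        using sum_le_suminf[OF sums_summable[OF exp_converges[of t]], of "{n}"] t
        by (simp add: sums_unique[OF exp_converges[of t]])
      thus ?thesis by (simp add: field_simps)
    qed
    finally have "t powr r * exp (- 2 * pi * t) \<le> (fact n * exp t) * exp (- 2 * t)"
      using t pi_gt3 by (intro mult_mono) auto
    thus ?thesis by (simp add: mult_exp_exp mult.assoc)
  qed
  thus ?thesis by (intro that[of "fact n"]) auto
qed

text \<open>The decay at \<open>0\<close> comes from the decay at \<open>\<infinity>\<close> through \<open>f (- 1 / z) = z ^ k * f z\<close>.\<close>

lemma cusp_form_imaginary_axis_decay:
  assumes "cusp_form k f"
  obtains C where "C \<ge> 0"
    "\<And>t. t > 0 \<Longrightarrow> norm (f (\<i> * of_real t)) * t powr r \<le> C * exp (- t)"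
proof -
  obtain C where C: "C \<ge> 0" "\<And>z. Im z \<ge> 1 \<Longrightarrow> norm (f z) \<le> C * exp (- 2 * pi * Im z)"
    using cusp_expansion_decay[OF cusp_form_expansion[OF assms], of 1] by auto
  obtain B1 where B1: "B1 \<ge> 0" "\<And>t. t \<ge> 1 \<Longrightarrow> t powr r * exp (- 2 * pi * t) \<le> B1 * exp (- t)"
    using powr_times_exp_bounded[of r] by blast
  obtain B2 where B2: "B2 \<ge> 0"
      "\<And>t. t \<ge> 1 \<Longrightarrow> t powr (real k - r) * exp (- 2 * pi * t) \<le> B2 * exp (- t)"
    using powr_times_exp_bounded[of "real k - r"] by blast
  define D where "D = C * B1 + C * B2 * exp 1"
  have "norm (f (\<i> * of_real t)) * t powr r \<le> D * exp (- t)" if t: "t > 0" for t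
  proof (cases "t \<ge> 1")
    case True
    have "norm (f (\<i> * of_real t)) * t powr r \<le> C * exp (- 2 * pi * t) * t powr r"
      using C(2)[of "\<i> * of_real t"] True by (intro mult_right_mono) auto
    also have "\<dots> \<le> C * (B1 * exp (- t))"
      using mult_left_mono[OF B1(2)[OF True] C(1)] by (simp add: mult_ac)
    also have "\<dots> \<le> D * exp (- t)"
      using C(1) B2(1) by (simp add: D_def algebra_simps)
    finally show ?thesis .
  next
    case False
    hence t1: "1 / t \<ge> 1" using t by simp
    have "f (- 1 / (\<i> * of_real t)) = (\<i> * of_real t) ^ k * f (\<i> * of_real t)"
    proof -
      have "\<forall>a b c d :: int. a * d - b * c = 1 \<longrightarrow>
        (\<forall>z. Im z > 0 \<longrightarrow> f ((of_int a * z + of_int b) / (of_int c * z + of_int d))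
             = (of_int c * z + of_int d) ^ k * f z)"
        using assms by (simp add: cusp_form_def)
      \<comment> \<open>The variables first occur in the order a, d, b, c, so this is the matrix
        with rows (0, -1) and (1, 0).\<close>
      from this[rule_format, of 0 0 "-1" 1 "\<i> * of_real t"] t show ?thesis by simp
    qed
    also have "- 1 / (\<i> * of_real t) = \<i> * of_real (1 / t)"
      using t by (simp add: field_simps)
    finally have "norm (f (\<i> * of_real (1 / t))) = t ^ k * norm (f (\<i> * of_real t))"
      using t by (simp add: norm_mult norm_power norm_divide)
    hence "norm (f (\<i> * of_real t)) * t powr r = norm (f (\<i> * of_real (1 / t))) * t powr (r - real k)"
      using t by (simp add: powr_diff powr_realpow field_simps)
    also have "t powr (r - real k) = (1 / t) powr (real k - r)"
      using t by (simp add: powr_divide powr_minus[symmetric] powr_diff field_simps)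
    also have "norm (f (\<i> * of_real (1 / t))) * (1 / t) powr (real k - r) \<le>
        C * exp (- 2 * pi * (1 / t)) * (1 / t) powr (real k - r)"
      using C(2)[of "\<i> * of_real (1 / t)"] t1 by (intro mult_right_mono) auto
    also have "\<dots> \<le> C * (B2 * exp (- (1 / t)))"
      using mult_left_mono[OF B2(2)[OF t1] C(1)] by (simp add: mult_ac)
    \<comment> \<open>For \<open>t < 1\<close> the bound in \<open>1 / t\<close> is weakened to one
      in \<open>t\<close>, so that a single majorant serves all \<open>t > 0\<close>; this is the
      source of \<open>exp 1\<close> in \<open>D\<close>.\<close>
    also have "C * (B2 * exp (- (1 / t))) \<le> C * (B2 * (exp 1 * exp (- t)))"
    proof -
      have "exp (- (1 / t)) \<le> exp 1 * exp (- t)"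
        using False t1 unfolding mult_exp_exp exp_le_cancel_iff by linarith
      thus ?thesis using C(1) B2(1) by (intro mult_left_mono)
    qed
    also have "\<dots> \<le> D * exp (- t)"
      using C(1) B1(1) by (simp add: D_def algebra_simps)
    finally show ?thesis .
  qed
  moreover have "D \<ge> 0" using C B1 B2 by (simp add: D_def)
  ultimately show ?thesis by (rule that[rotated])
qed

section \<open>Expansion of monomials in the variables and in their gaps\<close>

definition weak_comps :: "'a set \<Rightarrow> nat \<Rightarrow> ('a \<Rightarrow> nat) set" where
  "weak_comps A N = {\<alpha> \<in> PiE A (\<lambda>_. UNIV). sum \<alpha> A = N}"

lemma finite_weak_comps [intro]:
  assumes "finite A"
  shows "finite (weak_comps A N)"
proof (rule finite_subset)
  show "weak_comps A N \<subseteq> PiE A (\<lambda>_. {..N})"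
  proof
    fix \<alpha> assume "\<alpha> \<in> weak_comps A N"
    hence \<alpha>: "sum \<alpha> A = N" "\<alpha> \<in> extensional A" by (auto simp: weak_comps_def PiE_def)
    have "\<alpha> a \<le> N" if "a \<in> A" for a
      using member_le_sum[of a A \<alpha>] that assms \<alpha>(1) by simp
    with \<alpha>(2) show "\<alpha> \<in> PiE A (\<lambda>_. {..N})" by (simp add: PiE_iff)
  qed
qed (simp add: assms finite_PiE)

lemma multinomial_theorem:
  fixes x :: "'a \<Rightarrow> 'b :: field_char_0"
  assumes "finite A"
  shows "(\<Sum>a\<in>A. x a) ^ N =
           (\<Sum>\<alpha>\<in>weak_comps A N. fact N / (\<Prod>a\<in>A. fact (\<alpha> a)) * (\<Prod>a\<in>A. x a ^ \<alpha> a))"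
  using assms
proof (induction A arbitrary: N rule: finite_induct)
  case empty
  have "weak_comps ({} :: 'a set) N = (if N = 0 then {\<lambda>_. undefined} else {})"
    by (auto simp: weak_comps_def)
  thus ?case by (simp add: power_0_left)
next
  case (insert a A)
  define T where "T = (\<lambda>N \<alpha>. fact N / (\<Prod>a\<in>A. fact (\<alpha> a)) * (\<Prod>a\<in>A. x a ^ \<alpha> a))"
  have upd: "(\<Prod>b\<in>A. g b ((\<beta>(a := k)) b)) = (\<Prod>b\<in>A. g b (\<beta> b))"
    for g :: "'a \<Rightarrow> nat \<Rightarrow> 'b" and \<beta> k
    using insert.hyps by (intro prod.cong) auto
  have upds: "sum (\<beta>(a := k)) A = sum \<beta> A" for \<beta> :: "'a \<Rightarrow> nat" and k
    using insert.hyps by (intro sum.cong) auto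
  have "(\<Sum>b\<in>insert a A. x b) ^ N = (\<Sum>k\<le>N. of_nat (N choose k) * x a ^ k * (\<Sum>b\<in>A. x b) ^ (N - k))"
    using insert.hyps by (simp add: binomial_ring)
  also have "\<dots> = (\<Sum>k\<le>N. \<Sum>\<beta>\<in>weak_comps A (N - k). of_nat (N choose k) * x a ^ k * T (N - k) \<beta>)"
    unfolding insert.IH T_def by (simp add: sum_distrib_left)
  also have "\<dots> = (\<Sum>(k, \<beta>)\<in>(SIGMA k:{..N}. weak_comps A (N - k)).
      of_nat (N choose k) * x a ^ k * T (N - k) \<beta>)"
    using insert.hyps by (intro sum.Sigma) auto
  also have "\<dots> = (\<Sum>\<alpha>\<in>weak_comps (insert a A) N.
      fact N / (\<Prod>a\<in>insert a A. fact (\<alpha> a)) * (\<Prod>a\<in>insert a A. x a ^ \<alpha> a))"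
  \<comment> \<open>The binomial index \<open>k\<close> becomes the exponent of the new variable
    \<open>a\<close>. Resetting the value at \<open>a\<close> to \<open>undefined\<close> gives back
    a function that is extensional on \<open>A\<close>.\<close>
  proof (rule sum.reindex_bij_witness[of _ "\<lambda>\<alpha>. (\<alpha> a, \<alpha>(a := undefined))" "\<lambda>(k, \<beta>). \<beta>(a := k)"], goal_cases)
    case (1 p)
    thus ?case using insert.hyps by (auto simp: weak_comps_def PiE_iff extensional_def fun_eq_iff)
  next
    case (2 p)
    then obtain k \<beta> where p: "p = (k, \<beta>)" "k \<le> N" "\<beta> \<in> weak_comps A (N - k)" by auto
    have "sum (\<beta>(a := k)) (insert a A) = k + sum \<beta> A"
      using insert.hyps by (simp only: sum.insert upds fun_upd_same not_False_eq_True)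
    with p show ?case by (auto simp: weak_comps_def PiE_iff extensional_def)
  next
    case (3 \<alpha>)
    thus ?case by simp
  next
    case (4 \<alpha>)
    have "sum \<alpha> (insert a A) = \<alpha> a + sum (\<alpha>(a := undefined)) A"
      using insert.hyps by (simp only: sum.insert upds not_False_eq_True)
    moreover have "sum \<alpha> (insert a A) = N" "\<alpha> \<in> extensional (insert a A)"
      using 4 by (auto simp: weak_comps_def PiE_def)
    ultimately have "\<alpha> a \<le> N" "sum (\<alpha>(a := undefined)) A = N - \<alpha> a"
      "\<alpha>(a := undefined) \<in> extensional A"
      by (linarith, linarith, simp add: extensional_def)
    thus ?case by (simp add: weak_comps_def PiE_def)
  next
    case (5 p)
    then obtain k \<beta> where p: "p = (k, \<beta>)" "k \<le> N" by auto
    have "(\<Prod>b\<in>insert a A. fact ((\<beta>(a := k)) b) :: 'b) = fact k * (\<Prod>b\<in>A. fact (\<beta> b))"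
      using insert.hyps upd[of "\<lambda>_. fact" \<beta> k] by (simp only: prod.insert fun_upd_same simp_thms)
    moreover have "(\<Prod>b\<in>insert a A. x b ^ (\<beta>(a := k)) b) = x a ^ k * (\<Prod>b\<in>A. x b ^ \<beta> b)"
      using insert.hyps upd[of "\<lambda>b e. x b ^ e" \<beta> k] by (simp only: prod.insert fun_upd_same simp_thms)
    ultimately show ?case
      unfolding p(1) prod.case T_def using p(2) by (simp only: binomial_fact) simp
  qed
  finally show ?case .
qed

section \<open>Triangular arrays with prescribed sums and the coefficients A\<close>

lemma finite_tuples_same_sum [intro]: "finite (tuples_same_sum n m)"
proof (rule finite_subset)
  show "tuples_same_sum n m \<subseteq> PiE {1..n} (\<lambda>_. {..\<Sum>j=1..n. m j})"
  proof
    fix M assume M: "M \<in> tuples_same_sum n m"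
    hence "M j \<le> (\<Sum>j=1..n. m j)" if "j \<in> {1..n}" for j
      using member_le_sum[of j "{1..n}" M] that by (simp add: tuples_same_sum_def)
    with M show "M \<in> PiE {1..n} (\<lambda>_. {..\<Sum>j=1..n. m j})"
      by (auto simp: tuples_same_sum_def PiE_iff)
  qed
qed (auto intro: finite_PiE)

lemma prod_triangle:
  fixes g :: "nat \<times> nat \<Rightarrow> 'a :: comm_monoid_mult"
  shows "(\<Prod>p\<in>{(a, b). 1 \<le> a \<and> a \<le> b \<and> b \<le> n}. g p) = (\<Prod>b=1..n. \<Prod>a=1..b. g (a, b))"
proof -
  have "(\<Prod>b=1..n. \<Prod>a=1..b. g (a, b)) = (\<Prod>(b, a)\<in>(SIGMA b:{1..n}. {1..b}). g (a, b))"
    by (rule prod.Sigma) auto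
  also have "\<dots> = (\<Prod>p\<in>{(a, b). 1 \<le> a \<and> a \<le> b \<and> b \<le> n}. g p)"
    by (rule prod.reindex_bij_witness[of _ prod.swap prod.swap]) auto
  finally show ?thesis by (rule sym)
qed

text \<open>Stated in the locale because the additive instance compares the two marginal totals and
  the multiplicative one collects the powers of each variable.\<close>

lemma (in comm_monoid_set) swap_triangle:
  fixes g :: "nat \<Rightarrow> nat \<Rightarrow> 'a"
  shows "F (\<lambda>b. F (\<lambda>a. g a b) {1..b}) {1..n} = F (\<lambda>a. F (g a) {a..n}) {1..n}"
proof -
  have "F (\<lambda>b. F (\<lambda>a. g a b) {1..b}) {1..n} = F (\<lambda>b. F (\<lambda>a. g a b) {a. a \<in> {1..n} \<and> a \<le> b}) {1..n}"
    by (intro cong refl) auto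
  also have "\<dots> = F (\<lambda>a. F (g a) {b. b \<in> {1..n} \<and> a \<le> b}) {1..n}"
    by (intro swap_restrict [symmetric]) auto
  also have "\<dots> = F (\<lambda>a. F (g a) {a..n}) {1..n}"
    by (intro cong refl) auto
  finally show ?thesis .
qed

text \<open>The coefficients \<open>A\<close> arise by expanding \<open>(x\<^sub>1 + \<dots> + x\<^sub>b)\<^bsup>m b - 1\<^esup>\<close> for each \<open>b\<close> and collecting
  the exponents of each \<open>x\<^sub>a\<close>.\<close>

lemma prod_partial_sums_power:
  fixes x :: "nat \<Rightarrow> complex"
  assumes m: "\<And>j. j \<in> {1..n} \<Longrightarrow> m j > 0"
  shows "(\<Prod>b=1..n. (\<Sum>a=1..b. x a) ^ (m b - 1)) =
           (\<Sum>M\<in>tuples_same_sum n m. coeff_A n m M * (\<Prod>j=1..n. x j ^ (M j - 1)))"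
proof -
  define P where "P = {(a, b). 1 \<le> a \<and> a \<le> b \<and> b \<le> n}"
  define rows where "rows = {\<alpha> \<in> PiE P (\<lambda>_. UNIV). \<forall>b\<in>{1..n}. (\<Sum>a=1..b. \<alpha> (a, b)) + 1 = m b}"
  define cols where "cols = (\<lambda>\<alpha> :: nat \<times> nat \<Rightarrow> nat. \<lambda>j\<in>{1..n}. (\<Sum>b=j..n. \<alpha> (j, b)) + 1)"
  define h where "h = (\<lambda>\<alpha> :: nat \<times> nat \<Rightarrow> nat. (\<Prod>j=1..n. fact (m j - 1)) / (\<Prod>p\<in>P. fact (\<alpha> p)) *
      (\<Prod>j=1..n. x j ^ (cols \<alpha> j - 1)))"
  define \<Phi> where "\<Phi> = PiE {1..n} (\<lambda>b. weak_comps {1..b} (m b - 1))"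
  \<comment> \<open>\<open>i\<close> and \<open>j\<close> are mutually inverse currying maps: an
    array whose entries with second index \<open>b\<close> sum to \<open>m b - 1\<close> is the same
    as a choice, for each \<open>b\<close>, of one exponent vector in the multinomial expansion of
    the \<open>b\<close>-th factor.\<close>
  define i where "i = (\<lambda>\<alpha> :: nat \<times> nat \<Rightarrow> nat. \<lambda>b\<in>{1..n}. \<lambda>a\<in>{1..b}. \<alpha> (a, b))"
  define j where "j = (\<lambda>\<phi> :: nat \<Rightarrow> nat \<Rightarrow> nat. \<lambda>p\<in>P. \<phi> (snd p) (fst p))"
  have ji: "j (i \<alpha>) = \<alpha>" if "\<alpha> \<in> rows" for \<alpha>
    using that by (auto simp: rows_def i_def j_def P_def fun_eq_iff PiE_iff extensional_def)
  have ij: "i (j \<phi>) = \<phi>" if "\<phi> \<in> \<Phi>" for \<phi>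
  proof
    fix b
    show "i (j \<phi>) b = \<phi> b"
    proof (cases "b \<in> {1..n}")
      case True
      hence "\<phi> b \<in> extensional {1..b}" using that by (auto simp: \<Phi>_def weak_comps_def PiE_iff)
      with True show ?thesis by (auto simp: i_def j_def P_def fun_eq_iff extensional_def)
    next
      case False
      with that show ?thesis by (auto simp: \<Phi>_def i_def PiE_iff extensional_def)
    qed
  qed
  have i_mem: "i \<alpha> \<in> \<Phi>" if "\<alpha> \<in> rows" for \<alpha>
  proof -
    have "(\<Sum>a=1..b. \<alpha> (a, b)) + 1 = m b" if "b \<in> {1..n}" for b
      using \<open>\<alpha> \<in> rows\<close> that by (simp add: rows_def)
    hence "(\<Sum>a=1..b. \<alpha> (a, b)) = m b - 1" if "b \<in> {1..n}" for b using that by (metis diff_add_inverse2)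
    thus ?thesis by (auto simp: \<Phi>_def i_def weak_comps_def)
  qed
  have j_mem: "j \<phi> \<in> rows" if "\<phi> \<in> \<Phi>" for \<phi>
  proof -
    have "(\<Sum>a=1..b. j \<phi> (a, b)) + 1 = m b" if b: "b \<in> {1..n}" for b
    proof -
      have "(\<Sum>a=1..b. j \<phi> (a, b)) = sum (\<phi> b) {1..b}"
        using b by (intro sum.cong) (auto simp: j_def P_def)
      also have "\<dots> = m b - 1" using \<open>\<phi> \<in> \<Phi>\<close> b by (auto simp: \<Phi>_def weak_comps_def)
      finally show ?thesis using m[OF b] by simp
    qed
    thus ?thesis by (auto simp: rows_def j_def)
  qed
  have fin_rows: "finite rows"
  proof -
    have "finite \<Phi>" unfolding \<Phi>_def by (intro finite_PiE) auto
    moreover have "rows \<subseteq> j ` \<Phi>" using ji i_mem by (metis image_eqI subsetI)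
    ultimately show ?thesis by (rule finite_surj)
  qed
  have cols_mem: "cols \<alpha> \<in> tuples_same_sum n m" if "\<alpha> \<in> rows" for \<alpha>
  proof -
    have "(\<Sum>j=1..n. cols \<alpha> j) = (\<Sum>j=1..n. (\<Sum>b=j..n. \<alpha> (j, b)) + 1)"
      by (intro sum.cong) (auto simp: cols_def)
    \<comment> \<open>Double counting of all entries of the array; the summand 1 occurs
      \<open>n\<close> times on either side.\<close>
    also have "\<dots> = (\<Sum>b=1..n. (\<Sum>a=1..b. \<alpha> (a, b)) + 1)"
      unfolding sum.distrib sum.swap_triangle[of "\<lambda>a b. \<alpha> (a, b)" n] by (rule refl)
    also have "\<dots> = (\<Sum>b=1..n. m b)"
      using that by (intro sum.cong refl) (simp only: rows_def mem_Collect_eq Ball_def)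
    finally show ?thesis by (auto simp: tuples_same_sum_def cols_def)
  qed
  have "(\<Prod>b=1..n. (\<Sum>a=1..b. x a) ^ (m b - 1)) =
     (\<Prod>b=1..n. \<Sum>\<alpha>\<in>weak_comps {1..b} (m b - 1).
        fact (m b - 1) / (\<Prod>a=1..b. fact (\<alpha> a)) * (\<Prod>a=1..b. x a ^ \<alpha> a))"
    by (intro prod.cong refl multinomial_theorem) auto
  also have "\<dots> = (\<Sum>\<phi>\<in>\<Phi>. \<Prod>b=1..n.
        fact (m b - 1) / (\<Prod>a=1..b. fact (\<phi> b a)) * (\<Prod>a=1..b. x a ^ \<phi> b a))"
    unfolding \<Phi>_def by (intro prod_sum_PiE) auto
  also have "\<dots> = (\<Sum>\<alpha>\<in>rows. \<Prod>b=1..n.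
        fact (m b - 1) / (\<Prod>a=1..b. fact (\<alpha> (a, b))) * (\<Prod>a=1..b. x a ^ \<alpha> (a, b)))"
  proof (rule sum.reindex_bij_witness[of _ i j])
    fix \<phi> assume "\<phi> \<in> \<Phi>"
    have "j \<phi> (a, b) = \<phi> b a" if "b \<in> {1..n}" "a \<in> {1..b}" for a b
      using that by (simp add: j_def P_def)
    thus "(\<Prod>b=1..n. fact (m b - 1) / (\<Prod>a=1..b. fact (j \<phi> (a, b))) * (\<Prod>a=1..b. x a ^ j \<phi> (a, b))) =
        (\<Prod>b=1..n. fact (m b - 1) / (\<Prod>a=1..b. fact (\<phi> b a)) * (\<Prod>a=1..b. x a ^ \<phi> b a))"
      by (intro prod.cong refl arg_cong2[of _ _ _ _ "(*)"] arg_cong2[of _ _ _ _ "(/)"]) simp_all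
  qed (fact ij j_mem ji i_mem)+
  also have "\<dots> = (\<Sum>\<alpha>\<in>rows. h \<alpha>)"
  proof (intro sum.cong refl)
    fix \<alpha> assume "\<alpha> \<in> rows"
    have "(\<Prod>b=1..n. \<Prod>a=1..b. x a ^ \<alpha> (a, b)) = (\<Prod>a=1..n. \<Prod>b=a..n. x a ^ \<alpha> (a, b))"
      by (rule prod.swap_triangle[of "\<lambda>a b. x a ^ \<alpha> (a, b)" n])
    also have "\<dots> = (\<Prod>a=1..n. x a ^ (cols \<alpha> a - 1))"
      unfolding cols_def by (intro prod.cong refl) (simp add: power_sum)
    finally show "(\<Prod>b=1..n. fact (m b - 1) / (\<Prod>a=1..b. fact (\<alpha> (a, b))) * (\<Prod>a=1..b. x a ^ \<alpha> (a, b))) = h \<alpha>"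
      unfolding h_def P_def prod_triangle prod.distrib prod_dividef by simp
  qed
  \<comment> \<open>Arrays are grouped by the monomial they contribute to; the fibre over
    \<open>M\<close> is \<open>alpha_families n m M\<close>.\<close>
  also have "\<dots> = (\<Sum>M\<in>tuples_same_sum n m. \<Sum>\<alpha>\<in>{\<alpha>\<in>rows. cols \<alpha> = M}. h \<alpha>)"
    using cols_mem by (intro sum.group [symmetric] fin_rows) auto
  also have "\<dots> = (\<Sum>M\<in>tuples_same_sum n m. coeff_A n m M * (\<Prod>j=1..n. x j ^ (M j - 1)))"
  proof (intro sum.cong refl)
    fix M assume M: "M \<in> tuples_same_sum n m"
    have cols_eq: "cols \<alpha> = M \<longleftrightarrow> (\<forall>j\<in>{1..n}. (\<Sum>b=j..n. \<alpha> (j, b)) + 1 = M j)" for \<alpha>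
    proof
      assume *: "\<forall>j\<in>{1..n}. (\<Sum>b=j..n. \<alpha> (j, b)) + 1 = M j"
      show "cols \<alpha> = M"
      proof (rule extensionalityI)
        show "M \<in> extensional {1..n}" using M by (simp add: tuples_same_sum_def PiE_def)
        show "cols \<alpha> j = M j" if "j \<in> {1..n}" for j
          unfolding cols_def restrict_apply if_P[OF that] by (rule bspec[OF * that])
      qed (simp add: cols_def)
    qed (auto simp: cols_def)
    have "{\<alpha>\<in>rows. cols \<alpha> = M} = alpha_families n m M"
      unfolding cols_eq rows_def alpha_families_def P_def by blast
    moreover have "h \<alpha> = (\<Prod>j=1..n. fact (m j - 1)) / (\<Prod>p\<in>P. fact (\<alpha> p)) * (\<Prod>j=1..n. x j ^ (M j - 1))"
      if "cols \<alpha> = M" for \<alpha>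
      unfolding h_def that ..
    ultimately show "(\<Sum>\<alpha>\<in>{\<alpha>\<in>rows. cols \<alpha> = M}. h \<alpha>) = coeff_A n m M * (\<Prod>j=1..n. x j ^ (M j - 1))"
      unfolding coeff_A_def sum_distrib_right P_def by (intro sum.cong) blast+
  qed
  finally show ?thesis .
qed

section \<open>Gaps of a tuple and the coefficients B\<close>

definition gap :: "(nat \<Rightarrow> 'a :: ab_group_add) \<Rightarrow> nat \<Rightarrow> 'a" where
  "gap t j = t j - (if j \<le> 1 then 0 else t (j - 1))"

lemma sum_gap: "(\<Sum>j=1..n. gap t j) = (if n = 0 then 0 else t n)"
  by (induction n) (auto simp: gap_def)

lemma gap_telescope:
  fixes g :: "nat \<Rightarrow> int"
  shows "(\<Sum>j=1..n. g j - g (j - 1)) = g n - g 0"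
  by (induction n) auto

text \<open>Abel summation: each difference is counted once for every later endpoint. Applied to the
  chosen binomial exponents, it turns the weighted sign exponent in \<open>coeff_B\<close> into
  their plain sum.\<close>

lemma sum_weighted_telescope:
  fixes g :: "nat \<Rightarrow> int"
  assumes "g 0 = 0"
  shows "(\<Sum>j=1..n. (int n + 1 - int j) * (g j - g (j - 1))) = (\<Sum>j=1..n. g j)"
proof (induction n)
  case (Suc n)
  have "(\<Sum>j=1..Suc n. (int (Suc n) + 1 - int j) * (g j - g (j - 1))) =
     (\<Sum>j=1..n. (int n + 1 - int j) * (g j - g (j - 1)) + (g j - g (j - 1))) + (g (Suc n) - g n)"
    by (simp add: algebra_simps)
  also have "\<dots> = (\<Sum>j=1..Suc n. g j)"
    unfolding sum.distrib Suc.IH gap_telescope using assms by simp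
  finally show ?case .
qed auto

text \<open>The coefficients \<open>B\<close> arise from the binomial expansions of \<open>(t\<^sub>j\<^sub>+\<^sub>1 - t\<^sub>j)\<^bsup>m (j+1) - 1\<^esup>\<close>; with
  \<open>r\<^sub>j\<close> the exponent of \<open>- t\<^sub>j\<close> chosen there, \<open>M\<^sub>j - m\<^sub>j = r\<^sub>j - r\<^sub>j\<^sub>-\<^sub>1\<close>.\<close>

lemma prod_gap_power:
  fixes t :: "nat \<Rightarrow> complex"
  assumes m: "\<And>j. j \<in> {1..n} \<Longrightarrow> m j > 0" and n: "n \<ge> 1"
  shows "(\<Prod>j=1..n. gap t j ^ (m j - 1)) =
           (\<Sum>M\<in>tuples_same_sum n m. coeff_B n m M * (\<Prod>j=1..n. t j ^ (M j - 1)))"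
proof -
  obtain N where N: "n = Suc N" using n by (cases n) auto
  define R where "R = PiE {1..N} (\<lambda>j. {..m (Suc j) - 1})"
  \<comment> \<open>Padding by 0 at both ends: there is no variable before \<open>t 1\<close>, and
    \<open>t n\<close> is subtracted in no later gap.\<close>
  define \<rho> where "\<rho> = (\<lambda>r :: nat \<Rightarrow> nat. \<lambda>j. if j \<in> {1..N} then r j else 0)"
  define tup where "tup = (\<lambda>r. \<lambda>j\<in>{1..n}. m j + \<rho> r j - \<rho> r (j - 1))"
  \<comment> \<open>The differences \<open>M a - m a\<close> telescope, so these partial sums
    recover the exponents from \<open>M\<close>. They are also the lower entries of the binomials in
    \<open>coeff_B\<close>.\<close>
  define part where "part = (\<lambda>M j. \<Sum>a=1..j. int (M a) - int (m a))"
  define exps where "exps = (\<lambda>M. \<lambda>j\<in>{1..N}. nat (part M j))"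
  have \<rho>_le: "\<rho> r (j - 1) \<le> m j - 1" if "r \<in> R" "j \<in> {1..n}" for r j
  proof (cases "j = 1")
    case False
    hence "j - 1 \<in> {1..N}" "Suc (j - 1) = j" using that(2) N by auto
    with that(1) show ?thesis by (auto simp: R_def \<rho>_def PiE_iff dest!: bspec[of _ _ "j - 1"])
  qed (simp add: \<rho>_def)
  have tup_int: "int (tup r j) = int (m j) + int (\<rho> r j) - int (\<rho> r (j - 1))"
    if "r \<in> R" "j \<in> {1..n}" for r j
    using \<rho>_le[OF that] that(2) by (simp add: tup_def)
  have part_tup: "part (tup r) j = int (\<rho> r j)" if "r \<in> R" "j \<le> n" for r j
  proof -
    have "part (tup r) j = (\<Sum>a=1..j. int (\<rho> r a) - int (\<rho> r (a - 1)))"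
      unfolding part_def using that tup_int[OF that(1)] by (intro sum.cong) auto
    also have "\<dots> = int (\<rho> r j)"
      using gap_telescope[of "\<lambda>a. int (\<rho> r a)" j] by (simp add: \<rho>_def)
    finally show ?thesis .
  qed
  have tup_mem: "tup r \<in> tuples_same_sum n m" if r: "r \<in> R" for r
  proof -
    have "part (tup r) n = 0" using part_tup[OF r, of n] N by (simp add: \<rho>_def)
    hence "int (\<Sum>j=1..n. tup r j) = int (\<Sum>j=1..n. m j)"
      by (simp add: part_def sum_subtractf)
    hence "(\<Sum>j=1..n. tup r j) = (\<Sum>j=1..n. m j)" by (simp only: of_nat_eq_iff)
    moreover have "tup r j \<ge> 1" if j: "j \<in> {1..n}" for j
      using tup_int[OF r j] \<rho>_le[OF r j] m[OF j] by linarith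
    moreover have "tup r \<in> extensional {1..n}" by (simp add: tup_def)
    ultimately show ?thesis by (simp add: tuples_same_sum_def PiE_iff)
  qed
  define c where "c = (\<lambda>r. \<Prod>j=1..N. of_nat ((m (Suc j) - 1) choose r j) * (- 1) ^ r j :: complex)"
  have coeff_B_tup: "coeff_B n m (tup r) = c r" if r: "r \<in> R" for r
  proof -
    have 1: "(\<Prod>j=1..n-1. of_nat (int_binom (int (m (j + 1)) - 1) (\<Sum>a=1..j. int (tup r a) - int (m a)))) =
        (\<Prod>j=1..N. of_nat ((m (Suc j) - 1) choose r j) :: complex)"
    proof (intro prod.cong)
      fix j assume j: "j \<in> {1..N}"
      have "(\<Sum>a=1..j. int (tup r a) - int (m a)) = int (r j)"
        using part_tup[OF r, of j] j N by (simp add: part_def \<rho>_def)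
      moreover have "m (j + 1) > 0" "r j \<le> m (j + 1) - 1"
        using j N m[of "j + 1"] r by (auto simp: R_def PiE_iff)
      ultimately show "of_nat (int_binom (int (m (j + 1)) - 1) (\<Sum>a=1..j. int (tup r a) - int (m a))) =
          (of_nat ((m (Suc j) - 1) choose r j) :: complex)"
        by (auto simp: int_binom_def nat_diff_distrib)
    qed (simp add: N)
    have "(\<Sum>j=1..n. (int n + 1 - int j) * (int (tup r j) - int (m j))) =
        (\<Sum>j=1..n. (int n + 1 - int j) * (int (\<rho> r j) - int (\<rho> r (j - 1))))"
      using tup_int[OF r] by (intro sum.cong) auto
    also have "\<dots> = (\<Sum>j=1..n. int (\<rho> r j))"
      by (rule sum_weighted_telescope) (simp add: \<rho>_def)
    also have "\<dots> = int (\<Sum>j=1..N. r j)" by (simp add: N \<rho>_def)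
    finally have 2: "(- 1) powi (\<Sum>j=1..n. (int n + 1 - int j) * (int (tup r j) - int (m j))) =
        (\<Prod>j=1..N. (- 1) ^ r j :: complex)"
      by (simp only: power_int_of_nat power_sum)
    show ?thesis unfolding coeff_B_def 1 2 c_def by (simp only: prod.distrib mult.commute)
  qed
  \<comment> \<open>Every choice in \<open>R\<close> must give a tuple with nonzero coefficient,
    because the tuples with coefficient 0 are discarded in the reindexing below.\<close>
  have c_nonzero: "c r \<noteq> 0" if "r \<in> R" for r
    using that by (auto simp: c_def R_def PiE_iff not_less)
  have "(\<Prod>j=1..n. gap t j ^ (m j - 1)) = t 1 ^ (m 1 - 1) * (\<Prod>j=1..N. (t (Suc j) - t j) ^ (m (Suc j) - 1))"
  proof -
    have "(\<Prod>j=1..n. gap t j ^ (m j - 1)) = gap t 1 ^ (m 1 - 1) * (\<Prod>j=Suc 1..Suc N. gap t j ^ (m j - 1))"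
      unfolding N by (subst prod.atLeast_Suc_atMost) auto
    also have "(\<Prod>j=Suc 1..Suc N. gap t j ^ (m j - 1)) = (\<Prod>j=1..N. gap t (Suc j) ^ (m (Suc j) - 1))"
      by (rule prod.shift_bounds_cl_Suc_ivl)
    finally show ?thesis by (simp add: gap_def)
  qed
  also have "(\<Prod>j=1..N. (t (Suc j) - t j) ^ (m (Suc j) - 1)) =
      (\<Prod>j=1..N. \<Sum>k\<le>m (Suc j) - 1. of_nat ((m (Suc j) - 1) choose k) * (- t j) ^ k * t (Suc j) ^ (m (Suc j) - 1 - k))"
    unfolding binomial_ring [symmetric] by simp
  also have "\<dots> = (\<Sum>r\<in>R. \<Prod>j=1..N. of_nat ((m (Suc j) - 1) choose r j) * (- t j) ^ r j * t (Suc j) ^ (m (Suc j) - 1 - r j))"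
    unfolding R_def by (intro prod_sum_PiE) auto
  also have "t 1 ^ (m 1 - 1) * \<dots> = (\<Sum>r\<in>R. c r * (\<Prod>j=1..n. t j ^ (tup r j - 1)))"
    unfolding sum_distrib_left
  proof (intro sum.cong refl)
    fix r assume r: "r \<in> R"
    have "(\<Prod>j=1..n. t j ^ (tup r j - 1)) = (\<Prod>j=1..n. t j ^ \<rho> r j * t j ^ (m j - 1 - \<rho> r (j - 1)))"
    proof (intro prod.cong refl)
      fix j assume j: "j \<in> {1..n}"
      have "tup r j - 1 = \<rho> r j + (m j - 1 - \<rho> r (j - 1))"
        using tup_int[OF r j] \<rho>_le[OF r j] m[OF j] by linarith
      thus "t j ^ (tup r j - 1) = t j ^ \<rho> r j * t j ^ (m j - 1 - \<rho> r (j - 1))"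
        by (simp only: power_add)
    qed
    also have "\<dots> = (\<Prod>j=1..n. t j ^ \<rho> r j) * (\<Prod>j=1..n. t j ^ (m j - 1 - \<rho> r (j - 1)))"
      by (rule prod.distrib)
    also have "(\<Prod>j=1..n. t j ^ \<rho> r j) = (\<Prod>j=1..N. t j ^ r j)"
      by (simp add: N \<rho>_def)
    also have "(\<Prod>j=1..n. t j ^ (m j - 1 - \<rho> r (j - 1))) =
        t 1 ^ (m 1 - 1) * (\<Prod>j=Suc 1..Suc N. t j ^ (m j - 1 - \<rho> r (j - 1)))"
      unfolding N by (subst prod.atLeast_Suc_atMost) (auto simp: \<rho>_def)
    also have "(\<Prod>j=Suc 1..Suc N. t j ^ (m j - 1 - \<rho> r (j - 1))) =
        (\<Prod>j=1..N. t (Suc j) ^ (m (Suc j) - 1 - \<rho> r (Suc j - 1)))"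
      by (rule prod.shift_bounds_cl_Suc_ivl)
    also have "\<dots> = (\<Prod>j=1..N. t (Suc j) ^ (m (Suc j) - 1 - r j))"
      by (intro prod.cong) (auto simp: \<rho>_def)
    finally show "t 1 ^ (m 1 - 1) * (\<Prod>j=1..N. of_nat ((m (Suc j) - 1) choose r j) * (- t j) ^ r j *
        t (Suc j) ^ (m (Suc j) - 1 - r j)) = c r * (\<Prod>j=1..n. t j ^ (tup r j - 1))"
      by (simp only: c_def prod.distrib power_minus[of "t _"] mult_ac)
  qed
  also have "\<dots> = (\<Sum>M\<in>tuples_same_sum n m. coeff_B n m M * (\<Prod>j=1..n. t j ^ (M j - 1)))"
  \<comment> \<open>\<open>R\<close> corresponds only to the tuples with nonzero
    \<open>coeff_B\<close>; the others contribute nothing. Nonvanishing of the binomials is exactly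
    what forces the partial sums of such a tuple into the range required by
    \<open>R\<close>.\<close>
  proof (rule sum.reindex_bij_witness_not_neutral[of "{}" "{M\<in>tuples_same_sum n m. coeff_B n m M = 0}" _ exps tup])
    show "finite {M \<in> tuples_same_sum n m. coeff_B n m M = 0}"
      by (rule finite_subset[OF _ finite_tuples_same_sum]) blast
    fix r assume "r \<in> R - {}"
    hence r: "r \<in> R" by simp
    show "exps (tup r) = r"
    proof (rule extensionalityI)
      show "r \<in> extensional {1..N}" using r by (simp add: R_def PiE_def)
      show "exps (tup r) j = r j" if "j \<in> {1..N}" for j
        using part_tup[OF r, of j] that by (simp add: exps_def N \<rho>_def)
    qed (simp add: exps_def)
  next
    fix M assume "M \<in> tuples_same_sum n m - {M \<in> tuples_same_sum n m. coeff_B n m M = 0}"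
    hence M: "M \<in> tuples_same_sum n m" "coeff_B n m M \<noteq> 0" by auto
    have bnd: "0 \<le> part M j \<and> part M j \<le> int (m (Suc j)) - 1" if j: "j \<in> {1..N}" for j
    proof -
      have "int_binom (int (m (j + 1)) - 1) (part M j) \<noteq> 0"
        using M(2) j N by (auto simp: coeff_B_def part_def)
      thus ?thesis by (auto simp: int_binom_def split: if_splits)
    qed
    show exps_mem: "exps M \<in> R - {}"
    proof -
      have "nat (part M j) \<le> m (Suc j) - 1" if "j \<in> {1..N}" for j
        using bnd[OF that] by linarith
      thus ?thesis by (auto simp: exps_def R_def)
    qed
    hence ex: "exps M \<in> R" by simp
    have "int (\<Sum>j=1..n. M j) = int (\<Sum>j=1..n. m j)"
      using M(1) by (simp only: tuples_same_sum_def mem_Collect_eq)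
    hence part_n: "part M n = 0"
      by (simp add: part_def sum_subtractf)
    have \<rho>_exps: "int (\<rho> (exps M) j) = part M j" if "j \<le> n" for j
    proof (cases "j \<in> {1..N}")
      case True
      with bnd[OF True] show ?thesis by (simp add: \<rho>_def exps_def)
    next
      case False
      hence "j = 0 \<or> j = n" using that N by auto
      with part_n False show ?thesis by (auto simp: \<rho>_def part_def)
    qed
    show "tup (exps M) = M"
    proof (rule extensionalityI)
      show "M \<in> extensional {1..n}" using M(1) by (simp add: tuples_same_sum_def PiE_def)
      fix j assume j: "j \<in> {1..n}"
      have "int (tup (exps M) j) = int (m j) + part M j - part M (j - 1)"
      proof -
        have "j \<le> n" "j - 1 \<le> n" using j by auto
        thus ?thesis using tup_int[OF ex j] \<rho>_exps by presburger
      qed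
      moreover have "part M j = part M (j - 1) + (int (M j) - int (m j))"
      proof -
        obtain i where "j = Suc i" using j by (cases j) auto
        thus ?thesis by (simp add: part_def)
      qed
      ultimately show "tup (exps M) j = M j" by simp
    qed (simp add: tup_def)
  next
    fix r assume "r \<in> R"
    thus "coeff_B n m (tup r) * (\<Prod>j=1..n. t j ^ (tup r j - 1)) = c r * (\<Prod>j=1..n. t j ^ (tup r j - 1))"
      by (simp only: coeff_B_tup)
  qed (use tup_mem coeff_B_tup c_nonzero in auto)
  finally show ?thesis .
qed

section \<open>Gamma integrals over the ordered region\<close>

declare One_nat_def [simp del]

lemma borel_measurable_complex_powr [measurable]:
  assumes [measurable]: "g \<in> borel_measurable M"
  shows "(\<lambda>x. complex_of_real (g x) powr s) \<in> borel_measurable M"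
  unfolding powr_def by measurable

text \<open>Euler's integral under the substitution \<open>u = a * (y - c)\<close>. The shift leaves
  only the factor \<open>exp (- a * c)\<close>; with \<open>c\<close> the preceding variable, this
  factor can be passed on to the next integration.\<close>

lemma has_bochner_integral_Gamma:
  assumes s: "Re s > 0" and a: "a > 0"
  shows "has_bochner_integral lborel
    (\<lambda>y. if y > c then complex_of_real (y - c) powr (s - 1) * of_real (exp (- a * y)) else 0)
    (of_real (exp (- a * c)) * (Gamma s / of_real a powr s))"
proof -
  define G where "G = (\<lambda>u. if u > 0 then complex_of_real u powr (s - 1) * of_real (exp (- u)) else 0)"
  have G_eq: "G = (\<lambda>u. indicator {0<..} u *\<^sub>R (of_real u powr (s - 1) / of_real (exp u)))"
    by (auto simp: G_def fun_eq_iff exp_minus field_simps)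
  have meas: "G \<in> borel_measurable borel" unfolding G_def by measurable
  have "set_integrable lebesgue {0<..} (\<lambda>u. of_real u powr (s - 1) / of_real (exp u))"
    by (rule absolutely_integrable_Gamma_integral'[OF s])
  \<comment> \<open>Integrability is known for the completed measure and descends to
    \<open>lborel\<close> because \<open>G\<close> is Borel measurable.\<close>
  hence "integrable lborel G"
    unfolding set_integrable_def G_eq [symmetric] using meas by (subst (asm) integrable_completion) auto
  hence int: "set_integrable lborel {0<..} (\<lambda>u. of_real u powr (s - 1) / of_real (exp u))"
    unfolding set_integrable_def G_eq [symmetric] .
  have "integral\<^sup>L lborel G = integral {0<..} (\<lambda>u. of_real u powr (s - 1) / of_real (exp u))"
    using set_borel_integral_eq_integral(2)[OF int]
    unfolding set_lebesgue_integral_def G_eq [symmetric] .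
  also have "\<dots> = Gamma s" using Gamma_integral_complex'[OF s] by (rule integral_unique)
  finally have "has_bochner_integral lborel G (Gamma s)"
    using \<open>integrable lborel G\<close> by (simp add: has_bochner_integral_iff)
  hence "has_bochner_integral lborel (\<lambda>y. G (- a * c + a * y)) (Gamma s /\<^sub>R \<bar>a\<bar>)"
    using a by (subst (asm) lborel_has_bochner_integral_real_affine_iff[of a _ _ "- a * c"]) auto
  \<comment> \<open>This constant cancels the factors \<open>a powr (s - 1)\<close> and
    \<open>exp (a * c)\<close> that \<open>G (a * (y - c))\<close> carries in excess of the desired
    integrand.\<close>
  hence "has_bochner_integral lborel (\<lambda>y. (of_real a powr (1 - s) * of_real (exp (- a * c))) * G (- a * c + a * y))
      ((of_real a powr (1 - s) * of_real (exp (- a * c))) * (Gamma s /\<^sub>R \<bar>a\<bar>))"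
    by (intro has_bochner_integral_mult_right) auto
  also have "(\<lambda>y. (of_real a powr (1 - s) * of_real (exp (- a * c))) * G (- a * c + a * y)) =
    (\<lambda>y. if y > c then complex_of_real (y - c) powr (s - 1) * of_real (exp (- a * y)) else 0)"
  proof
    fix y
    have *: "- a * c + a * y = a * (y - c)" by (simp add: algebra_simps)
    have pos: "a * (y - c) > 0 \<longleftrightarrow> y > c" using a by (simp add: zero_less_mult_iff)
    show "(of_real a powr (1 - s) * of_real (exp (- a * c))) * G (- a * c + a * y) =
      (if y > c then complex_of_real (y - c) powr (s - 1) * of_real (exp (- a * y)) else 0)"
    proof (cases "y > c")
      case True
      have "exp (- a * c) * exp (- (a * (y - c))) = exp (- a * y)"
        unfolding mult_exp_exp by (simp add: algebra_simps)
      hence e: "complex_of_real (exp (- a * c)) * of_real (exp (- (a * (y - c)))) = of_real (exp (- a * y))"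
        unfolding of_real_mult [symmetric] by (rule arg_cong)
      have "complex_of_real (a * (y - c)) powr (s - 1) = of_real a powr (s - 1) * of_real (y - c) powr (s - 1)"
        using a True by (subst of_real_mult, subst powr_times_real) auto
      moreover have "complex_of_real a powr (1 - s) * of_real a powr (s - 1) = 1"
        using a by (simp flip: powr_add)
      ultimately have "complex_of_real a powr (1 - s) * of_real (a * (y - c)) powr (s - 1) = of_real (y - c) powr (s - 1)"
        by (simp only: mult.assoc [symmetric] mult_1)
      hence "(complex_of_real a powr (1 - s) * of_real (a * (y - c)) powr (s - 1)) *
          (complex_of_real (exp (- a * c)) * of_real (exp (- (a * (y - c))))) =
          of_real (y - c) powr (s - 1) * of_real (exp (- a * y))"
        by (simp only: e)
      thus ?thesis using True pos unfolding * G_def by (simp only: if_True mult_ac)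
    next
      case False
      with pos show ?thesis unfolding * G_def by (simp only: if_False mult_zero_right)
    qed
  qed
  also have "(of_real a powr (1 - s) * of_real (exp (- a * c))) * (Gamma s /\<^sub>R \<bar>a\<bar>) =
      of_real (exp (- a * c)) * (Gamma s / of_real a powr s)"
  proof -
    have "complex_of_real a powr (1 - s) = of_real a / of_real a powr s"
      using a by (simp add: powr_diff)
    thus ?thesis using a by (simp add: scaleR_conv_of_real)
  qed
  finally show ?thesis .
qed

text \<open>Passing to absolute values replaces \<open>s\<close> by its real part, so this is the
  preceding integral at a real exponent.\<close>

lemma nn_integral_Gamma:
  assumes s: "Re s > 0" and a: "a > 0"
  shows "(\<integral>\<^sup>+y. ennreal (norm (if y > c then complex_of_real (y - c) powr (s - 1) * of_real (exp (- a * y)) else 0)) \<partial>lborel)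
     = ennreal (exp (- a * c) * (Gamma (Re s) / a powr Re s))"
proof -
  define r where "r = complex_of_real (Re s)"
  define F where "F = (\<lambda>s y. if y > c then complex_of_real (y - c) powr (s - 1) * of_real (exp (- a * y)) else 0)"
  have hb: "has_bochner_integral lborel (F r) (of_real (exp (- a * c)) * (Gamma r / of_real a powr r))"
    unfolding F_def using has_bochner_integral_Gamma[of r a c] s a by (simp add: r_def)
  have "norm (F s y) = Re (F r y)" for y
  proof (cases "y > c")
    case True
    have "norm (complex_of_real (y - c) powr (s - 1)) = (y - c) powr (Re s - 1)"
      using True by (subst norm_powr_real_powr) auto
    moreover have "complex_of_real (y - c) powr (r - 1) = of_real ((y - c) powr (Re s - 1))"
    proof -
      have "r - 1 = of_real (Re s - 1)" by (simp add: r_def)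
      thus ?thesis using True by (simp only: powr_of_real diff_ge_0_iff_ge less_imp_le)
    qed
    ultimately show ?thesis using True by (simp add: F_def norm_mult del: of_real_diff)
  qed (simp add: F_def)
  moreover have "has_bochner_integral lborel (\<lambda>y. Re (F r y)) (exp (- a * c) * (Gamma (Re s) / a powr Re s))"
  proof -
    have "of_real (exp (- a * c)) * (Gamma r / of_real a powr r) =
        complex_of_real (exp (- a * c) * (Gamma (Re s) / a powr Re s))"
      using a by (simp add: r_def Gamma_complex_of_real powr_of_real)
    with has_bochner_integral_Re[OF hb] show ?thesis by (simp only: Re_complex_of_real)
  qed
  ultimately have "has_bochner_integral lborel (\<lambda>y. norm (F s y)) (exp (- a * c) * (Gamma (Re s) / a powr Re s))"
    by (simp only:)
  hence "(\<integral>\<^sup>+y. ennreal (norm (F s y)) \<partial>lborel) = ennreal (exp (- a * c) * (Gamma (Re s) / a powr Re s))"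
    by (subst nn_integral_eq_integral) (auto simp: has_bochner_integral_iff)
  thus ?thesis by (simp only: F_def)
qed

interpretation lborel_product: product_sigma_finite "\<lambda>_ :: nat. lborel :: real measure"
  by standard

lemma borel_measurable_component_gap:
  assumes "j \<in> {1..n}"
  shows "(\<lambda>t. t j) \<in> borel_measurable (Pi\<^sub>M {1..n} (\<lambda>_. lborel :: real measure))"
    and "(\<lambda>t. gap t j) \<in> borel_measurable (Pi\<^sub>M {1..n} (\<lambda>_. lborel :: real measure))"
proof -
  have *: "(\<lambda>t. t i) \<in> borel_measurable (Pi\<^sub>M {1..n} (\<lambda>_. lborel :: real measure))" if "i \<in> {1..n}" for i
    using measurable_component_singleton[OF that, of "\<lambda>_. lborel :: real measure"] by simp
  from *[OF assms] show "(\<lambda>t. t j) \<in> borel_measurable (Pi\<^sub>M {1..n} (\<lambda>_. lborel :: real measure))" .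
  have "j - 1 \<in> {1..n}" if "\<not> j \<le> 1" using assms that by auto
  thus "(\<lambda>t. gap t j) \<in> borel_measurable (Pi\<^sub>M {1..n} (\<lambda>_. lborel :: real measure))"
    unfolding gap_def using *[OF assms] * by (cases "j \<le> 1") auto
qed

text \<open>The part of the integrand belonging to one index of the Dirichlet series:
  \<open>f j\<close> is replaced by the exponential of its \<open>l j\<close>-th Fourier term, with
  \<open>\<mu> j = 2 * pi * l j\<close>. The cutoffs confine the support to increasing positive
  tuples.\<close>

definition gap_kernel :: "nat \<Rightarrow> (nat \<Rightarrow> complex) \<Rightarrow> (nat \<Rightarrow> real) \<Rightarrow> (nat \<Rightarrow> real) \<Rightarrow> complex" where
  "gap_kernel n s \<mu> t = (\<Prod>j=1..n. if gap t j > 0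
     then complex_of_real (gap t j) powr (s j - 1) * of_real (exp (- \<mu> j * t j)) else 0)"

lemma borel_measurable_gap_kernel [measurable]:
  "gap_kernel n s \<mu> \<in> borel_measurable (Pi\<^sub>M {1..n} (\<lambda>_. lborel))"
  unfolding gap_kernel_def
proof (rule borel_measurable_prod)
  fix j assume j: "j \<in> {1..n}"
  note [measurable] = borel_measurable_component_gap[OF j]
  show "(\<lambda>t. if gap t j > 0 then complex_of_real (gap t j) powr (s j - 1) * of_real (exp (- \<mu> j * t j)) else 0)
      \<in> borel_measurable (Pi\<^sub>M {1..n} (\<lambda>_. lborel))" by measurable
qed

lemma gap_kernel_Suc:
  "gap_kernel (Suc n) s \<mu> (t(Suc n := y)) = gap_kernel n s \<mu> t *
     (if y > (if n = 0 then 0 else t n)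
      then complex_of_real (y - (if n = 0 then 0 else t n)) powr (s (Suc n) - 1) * of_real (exp (- \<mu> (Suc n) * y)) else 0)"
proof -
  have "gap (t(Suc n := y)) j = gap t j" if "j \<in> {1..n}" for j
    using that by (auto simp: gap_def)
  hence "(\<Prod>j=1..n. if gap (t(Suc n := y)) j > 0
     then complex_of_real (gap (t(Suc n := y)) j) powr (s j - 1) * of_real (exp (- \<mu> j * (t(Suc n := y)) j)) else 0)
     = gap_kernel n s \<mu> t"
    unfolding gap_kernel_def by (intro prod.cong) auto
  moreover have "gap (t(Suc n := y)) (Suc n) = y - (if n = 0 then 0 else t n)"
    by (simp add: gap_def)
  ultimately show ?thesis
    unfolding gap_kernel_def[of "Suc n"] prod.cl_ivl_Suc by simp
qed

text \<open>Integrating out \<open>t (Suc n)\<close> leaves a factor \<open>exp (- \<mu> (Suc n) * t n)\<close>, which is absorbed into \<open>\<mu> n\<close>.\<close>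

lemma gap_kernel_merge:
  "gap_kernel n s \<mu> t * of_real (exp (- \<mu> (Suc n) * (if n = 0 then 0 else t n))) =
     gap_kernel n s (\<mu>(n := \<mu> n + \<mu> (Suc n))) t"
proof (cases n)
  case (Suc m)
  have "(\<Prod>j=1..m. if gap t j > 0
     then complex_of_real (gap t j) powr (s j - 1) * of_real (exp (- (\<mu>(n := \<mu> n + \<mu> (Suc n))) j * t j)) else 0) =
     (\<Prod>j=1..m. if gap t j > 0
     then complex_of_real (gap t j) powr (s j - 1) * of_real (exp (- \<mu> j * t j)) else 0)"
    using Suc by (intro prod.cong) auto
  moreover have "exp (- (\<mu> n + \<mu> (Suc n)) * t n) = exp (- \<mu> n * t n) * exp (- \<mu> (Suc n) * t n)"
    unfolding mult_exp_exp by (simp add: algebra_simps)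
  ultimately show ?thesis
    unfolding gap_kernel_def Suc prod.cl_ivl_Suc by (simp add: algebra_simps)
qed (simp add: gap_kernel_def)

text \<open>Moving \<open>\<mu> (Suc n)\<close> into \<open>\<mu> n\<close> preserves every tail sum
  starting at some \<open>j \<le> n\<close>. In this way the denominators
  \<open>l\<^sub>j + \<dots> + l\<^sub>n\<close> build up; \<open>g\<close> is arbitrary so that the
  real and the complex evaluation share the argument.\<close>

lemma prod_tail_merge:
  fixes \<mu> :: "nat \<Rightarrow> real"
  shows "(\<Prod>j=1..n. g j (\<Sum>i=j..n. (\<mu>(n := \<mu> n + \<mu> (Suc n))) i)) * g (Suc n) (\<mu> (Suc n)) =
     (\<Prod>j=1..Suc n. g j (\<Sum>i=j..Suc n. \<mu> i))"
proof -
  have "(\<Sum>i=j..n. (\<mu>(n := \<mu> n + \<mu> (Suc n))) i) = (\<Sum>i=j..Suc n. \<mu> i)" if j: "j \<in> {1..n}" for j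
  proof -
    obtain m where m: "n = Suc m" using j by (cases n) auto
    have "(\<Sum>i=j..m. (\<mu>(n := \<mu> n + \<mu> (Suc n))) i) = (\<Sum>i=j..m. \<mu> i)"
      using m by (intro sum.cong) auto
    thus ?thesis using j m by simp
  qed
  hence "(\<Prod>j=1..n. g j (\<Sum>i=j..n. (\<mu>(n := \<mu> n + \<mu> (Suc n))) i)) = (\<Prod>j=1..n. g j (\<Sum>i=j..Suc n. \<mu> i))"
    by (intro prod.cong) auto
  thus ?thesis by (simp add: prod.cl_ivl_Suc)
qed

text \<open>The largest variable is integrated out first, with \<open>\<mu>\<close> changing along
  the induction. Tonelli presupposes no integrability, and the finite value found here is what
  licenses Fubini for the complex integral in \<open>integral_gap_kernel\<close>.\<close>

lemma nn_integral_gap_kernel: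
  assumes "\<And>j. j \<in> {1..n} \<Longrightarrow> Re (s j) > 0" "\<And>j. j \<in> {1..n} \<Longrightarrow> \<mu> j > 0"
  shows "(\<integral>\<^sup>+t. ennreal (norm (gap_kernel n s \<mu> t)) \<partial>Pi\<^sub>M {1..n} (\<lambda>_. lborel)) =
     ennreal (\<Prod>j=1..n. Gamma (Re (s j)) / (\<Sum>i=j..n. \<mu> i) powr Re (s j))"
  using assms
proof (induction n arbitrary: \<mu>)
  case 0
  show ?case by (simp add: gap_kernel_def PiM_empty nn_integral_count_space_finite)
next
  case (Suc n)
  define \<mu>' where "\<mu>' = \<mu>(n := \<mu> n + \<mu> (Suc n))"
  have \<mu>': "\<mu>' j > 0" if "j \<in> {1..n}" for j
    using Suc.prems(2)[of j] Suc.prems(2)[of "Suc n"] that by (auto simp: \<mu>'_def)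
  define K where "K = Gamma (Re (s (Suc n))) / \<mu> (Suc n) powr Re (s (Suc n))"
  have s: "Re (s (Suc n)) > 0" "\<mu> (Suc n) > 0" using Suc.prems by auto
  have K: "K \<ge> 0" using s by (simp add: K_def Gamma_real_pos less_imp_le)
  have ins: "{1..Suc n} = insert (Suc n) {1..n}" by auto
  have [measurable]: "gap_kernel (Suc n) s \<mu> \<in> borel_measurable (Pi\<^sub>M (insert (Suc n) {1..n}) (\<lambda>_. lborel))"
    using borel_measurable_gap_kernel[of "Suc n"] by (simp only: ins)
  have "(\<integral>\<^sup>+t. ennreal (norm (gap_kernel (Suc n) s \<mu> t)) \<partial>Pi\<^sub>M {1..Suc n} (\<lambda>_. lborel)) =
     (\<integral>\<^sup>+t. (\<integral>\<^sup>+y. ennreal (norm (gap_kernel (Suc n) s \<mu> (t(Suc n := y)))) \<partial>lborel) \<partial>Pi\<^sub>M {1..n} (\<lambda>_. lborel))"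
    unfolding ins by (subst lborel_product.product_nn_integral_insert) auto
  also have "\<dots> = (\<integral>\<^sup>+t. ennreal (norm (gap_kernel n s \<mu>' t)) * ennreal K \<partial>Pi\<^sub>M {1..n} (\<lambda>_. lborel))"
  proof (rule nn_integral_cong)
    fix t :: "nat \<Rightarrow> real"
    define c where "c = (if n = 0 then 0 else t n)"
    have "(\<integral>\<^sup>+y. ennreal (norm (gap_kernel (Suc n) s \<mu> (t(Suc n := y)))) \<partial>lborel) =
       (\<integral>\<^sup>+y. ennreal (norm (gap_kernel n s \<mu> t)) * ennreal (norm (if y > c
          then complex_of_real (y - c) powr (s (Suc n) - 1) * of_real (exp (- \<mu> (Suc n) * y)) else 0)) \<partial>lborel)"
      unfolding gap_kernel_Suc c_def [symmetric] norm_mult by (simp only: ennreal_mult norm_ge_zero)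
    also have "\<dots> = ennreal (norm (gap_kernel n s \<mu> t)) * ennreal (exp (- \<mu> (Suc n) * c) * K)"
      unfolding K_def nn_integral_Gamma[OF s, of c, symmetric] by (rule nn_integral_cmult) measurable
    also have "\<dots> = ennreal (norm (gap_kernel n s \<mu> t * of_real (exp (- \<mu> (Suc n) * c)))) * ennreal K"
      using K by (simp add: norm_mult mult_ac flip: ennreal_mult)
    also have "gap_kernel n s \<mu> t * of_real (exp (- \<mu> (Suc n) * c)) = gap_kernel n s \<mu>' t"
      unfolding c_def \<mu>'_def by (rule gap_kernel_merge)
    finally show "(\<integral>\<^sup>+y. ennreal (norm (gap_kernel (Suc n) s \<mu> (t(Suc n := y)))) \<partial>lborel) =
      ennreal (norm (gap_kernel n s \<mu>' t)) * ennreal K" .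
  qed
  also have "\<dots> = ennreal (\<Prod>j=1..n. Gamma (Re (s j)) / (\<Sum>i=j..n. \<mu>' i) powr Re (s j)) * ennreal K"
  proof -
    have "(\<integral>\<^sup>+t. ennreal (norm (gap_kernel n s \<mu>' t)) \<partial>Pi\<^sub>M {1..n} (\<lambda>_. lborel)) =
        ennreal (\<Prod>j=1..n. Gamma (Re (s j)) / (\<Sum>i=j..n. \<mu>' i) powr Re (s j))"
      using Suc.prems \<mu>' by (intro Suc.IH) auto
    thus ?thesis by (subst nn_integral_multc) simp_all
  qed
  also have "\<dots> = ennreal ((\<Prod>j=1..n. Gamma (Re (s j)) / (\<Sum>i=j..n. \<mu>' i) powr Re (s j)) * K)"
    using K Suc.prems(1)
    by (intro ennreal_mult [symmetric] prod_nonneg ballI divide_nonneg_nonneg less_imp_le[OF Gamma_real_pos]) auto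
  also have "(\<Prod>j=1..n. Gamma (Re (s j)) / (\<Sum>i=j..n. \<mu>' i) powr Re (s j)) * K =
      (\<Prod>j=1..Suc n. Gamma (Re (s j)) / (\<Sum>i=j..Suc n. \<mu> i) powr Re (s j))"
    unfolding K_def \<mu>'_def by (rule prod_tail_merge)
  finally show ?case .
qed

lemma integrable_gap_kernel:
  assumes "\<And>j. j \<in> {1..n} \<Longrightarrow> Re (s j) > 0" "\<And>j. j \<in> {1..n} \<Longrightarrow> \<mu> j > 0"
  shows "integrable (Pi\<^sub>M {1..n} (\<lambda>_. lborel)) (gap_kernel n s \<mu>)"
proof (rule integrableI_bounded)
  have "(\<integral>\<^sup>+t. ennreal (norm (gap_kernel n s \<mu> t)) \<partial>Pi\<^sub>M {1..n} (\<lambda>_. lborel)) =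
     ennreal (\<Prod>j=1..n. Gamma (Re (s j)) / (\<Sum>i=j..n. \<mu> i) powr Re (s j))"
    using assms by (rule nn_integral_gap_kernel)
  thus "(\<integral>\<^sup>+t. ennreal (norm (gap_kernel n s \<mu> t)) \<partial>Pi\<^sub>M {1..n} (\<lambda>_. lborel)) < \<infinity>"
    by (simp add: less_top)
qed measurable

lemma integral_norm_gap_kernel:
  assumes "\<And>j. j \<in> {1..n} \<Longrightarrow> Re (s j) > 0" "\<And>j. j \<in> {1..n} \<Longrightarrow> \<mu> j > 0"
  shows "(\<integral>t. norm (gap_kernel n s \<mu> t) \<partial>Pi\<^sub>M {1..n} (\<lambda>_. lborel)) =
     (\<Prod>j=1..n. Gamma (Re (s j)) / (\<Sum>i=j..n. \<mu> i) powr Re (s j))"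
proof -
  have "(\<integral>\<^sup>+t. ennreal (norm (gap_kernel n s \<mu> t)) \<partial>Pi\<^sub>M {1..n} (\<lambda>_. lborel)) =
     ennreal (\<Prod>j=1..n. Gamma (Re (s j)) / (\<Sum>i=j..n. \<mu> i) powr Re (s j))"
    using assms by (rule nn_integral_gap_kernel)
  moreover have "(\<Prod>j=1..n. Gamma (Re (s j)) / (\<Sum>i=j..n. \<mu> i) powr Re (s j)) \<ge> 0"
    using assms(1) by (intro prod_nonneg ballI divide_nonneg_nonneg less_imp_le[OF Gamma_real_pos]) auto
  ultimately show ?thesis by (subst integral_eq_nn_integral) auto
qed

lemma integral_gap_kernel:
  assumes "\<And>j. j \<in> {1..n} \<Longrightarrow> Re (s j) > 0" "\<And>j. j \<in> {1..n} \<Longrightarrow> \<mu> j > 0"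
  shows "(\<integral>t. gap_kernel n s \<mu> t \<partial>Pi\<^sub>M {1..n} (\<lambda>_. lborel)) =
     (\<Prod>j=1..n. Gamma (s j) / of_real (\<Sum>i=j..n. \<mu> i) powr s j)"
  using assms
proof (induction n arbitrary: \<mu>)
  case 0
  show ?case by (simp add: gap_kernel_def PiM_empty lebesgue_integral_count_space_finite)
next
  case (Suc n)
  define \<mu>' where "\<mu>' = \<mu>(n := \<mu> n + \<mu> (Suc n))"
  have \<mu>': "\<mu>' j > 0" if "j \<in> {1..n}" for j
    using Suc.prems(2)[of j] Suc.prems(2)[of "Suc n"] that by (auto simp: \<mu>'_def)
  define K where "K = Gamma (s (Suc n)) / of_real (\<mu> (Suc n)) powr s (Suc n)"
  have s: "Re (s (Suc n)) > 0" "\<mu> (Suc n) > 0" using Suc.prems by auto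
  have ins: "{1..Suc n} = insert (Suc n) {1..n}" by auto
  have "integrable (Pi\<^sub>M (insert (Suc n) {1..n}) (\<lambda>_. lborel)) (gap_kernel (Suc n) s \<mu>)"
    unfolding ins [symmetric] using Suc.prems by (rule integrable_gap_kernel)
  hence "(\<integral>t. gap_kernel (Suc n) s \<mu> t \<partial>Pi\<^sub>M {1..Suc n} (\<lambda>_. lborel)) =
     (\<integral>t. (\<integral>y. gap_kernel (Suc n) s \<mu> (t(Suc n := y)) \<partial>lborel) \<partial>Pi\<^sub>M {1..n} (\<lambda>_. lborel))"
    unfolding ins by (intro lborel_product.product_integral_insert) auto
  also have "\<dots> = (\<integral>t. gap_kernel n s \<mu>' t * K \<partial>Pi\<^sub>M {1..n} (\<lambda>_. lborel))"
  proof (rule Bochner_Integration.integral_cong[OF refl])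
    fix t :: "nat \<Rightarrow> real"
    define c where "c = (if n = 0 then 0 else t n)"
    have "(\<integral>y. gap_kernel (Suc n) s \<mu> (t(Suc n := y)) \<partial>lborel) =
       gap_kernel n s \<mu> t * (of_real (exp (- \<mu> (Suc n) * c)) * K)"
      unfolding gap_kernel_Suc c_def [symmetric] K_def
      by (intro has_bochner_integral_integral_eq has_bochner_integral_mult_right has_bochner_integral_Gamma[OF s])
    also have "\<dots> = (gap_kernel n s \<mu> t * of_real (exp (- \<mu> (Suc n) * c))) * K"
      by (rule mult.assoc [symmetric])
    also have "gap_kernel n s \<mu> t * of_real (exp (- \<mu> (Suc n) * c)) = gap_kernel n s \<mu>' t"
      unfolding c_def \<mu>'_def by (rule gap_kernel_merge)
    finally show "(\<integral>y. gap_kernel (Suc n) s \<mu> (t(Suc n := y)) \<partial>lborel) = gap_kernel n s \<mu>' t * K" .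
  qed
  also have "\<dots> = (\<Prod>j=1..n. Gamma (s j) / of_real (\<Sum>i=j..n. \<mu>' i) powr s j) * K"
  proof -
    have "(\<integral>t. gap_kernel n s \<mu>' t \<partial>Pi\<^sub>M {1..n} (\<lambda>_. lborel)) =
        (\<Prod>j=1..n. Gamma (s j) / of_real (\<Sum>i=j..n. \<mu>' i) powr s j)"
      using Suc.prems \<mu>' by (intro Suc.IH) auto
    thus ?thesis by (simp only: integral_mult_left_zero)
  qed
  also have "\<dots> = (\<Prod>j=1..Suc n. Gamma (s j) / of_real (\<Sum>i=j..Suc n. \<mu> i) powr s j)"
    unfolding K_def \<mu>'_def by (rule prod_tail_merge[of "\<lambda>j x. Gamma (s j) / of_real x powr s j"])
  finally show ?case .
qed

section \<open>Termwise integration\<close>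

text \<open>Interchange of sum and integral for unordered sums: an enumeration of the infinite
  countable index set reduces it to a series whose L1 norms are summable, and absolute convergence
  makes the result independent of the order.\<close>

lemma has_sum_integral:
  fixes G :: "'i \<Rightarrow> 'a \<Rightarrow> complex"
  assumes A: "countable A" "infinite A"
    and int: "\<And>i. i \<in> A \<Longrightarrow> integrable M (G i)"
    and sm: "(\<lambda>i. \<integral>x. norm (G i x) \<partial>M) summable_on A"
    and hs: "\<And>x. x \<in> space M \<Longrightarrow> ((\<lambda>i. G i x) has_sum F x) A"
  shows "integrable M F" and "((\<lambda>i. \<integral>x. G i x \<partial>M) has_sum (\<integral>x. F x \<partial>M)) A"
proof -
  define e where "e = from_nat_into A"
  have e: "bij_betw e UNIV A" unfolding e_def using A by (rule bij_betw_from_nat_into)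
  have eA: "e i \<in> A" for i using bij_betwE[OF e] by auto
  have pt: "(\<lambda>i. G (e i) x) sums F x \<and> summable (\<lambda>i. norm (G (e i) x))" if "x \<in> space M" for x
  proof -
    have *: "((\<lambda>i. G (e i) x) has_sum F x) UNIV"
      using hs[OF that] by (subst has_sum_reindex_bij_betw[OF e])
    have "(\<lambda>i. norm (G (e i) x)) summable_on UNIV"
      using has_sum_imp_summable[OF *] by (simp only: summable_on_iff_abs_summable_on_complex)
    with * show ?thesis by (auto intro: has_sum_imp_sums summable_on_imp_summable)
  qed
  have "(\<lambda>i. \<integral>x. norm (G (e i) x) \<partial>M) summable_on UNIV"
    using sm by (subst summable_on_reindex_bij_betw[OF e])
  hence sm': "summable (\<lambda>i. \<integral>x. norm (G (e i) x) \<partial>M)" by (rule summable_on_imp_summable)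
  have ae: "AE x in M. summable (\<lambda>i. norm (G (e i) x))" using pt by auto
  have F: "(\<Sum>i. G (e i) x) = F x" if "x \<in> space M" for x
    using pt[OF that] by (auto simp: sums_iff)
  have "integrable M (\<lambda>x. \<Sum>i. G (e i) x)"
    using ae sm' by (intro integrable_suminf int eA)
  thus "integrable M F" using F by (simp cong: Bochner_Integration.integrable_cong)
  have "(\<lambda>i. \<integral>x. G (e i) x \<partial>M) sums (\<integral>x. (\<Sum>i. G (e i) x) \<partial>M)"
    using ae sm' by (intro sums_integral int eA)
  also have "(\<integral>x. (\<Sum>i. G (e i) x) \<partial>M) = (\<integral>x. F x \<partial>M)"
    using F by (intro Bochner_Integration.integral_cong) auto
  finally have "(\<lambda>i. \<integral>x. G (e i) x \<partial>M) sums (\<integral>x. F x \<partial>M)" .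
  moreover have "summable (\<lambda>i. norm (\<integral>x. G (e i) x \<partial>M))"
    by (rule summable_comparison_test'[OF sm', of 0]) (simp add: integral_norm_bound)
  ultimately have "((\<lambda>i. \<integral>x. G (e i) x \<partial>M) has_sum (\<integral>x. F x \<partial>M)) UNIV"
    by (intro norm_summable_imp_has_sum)
  thus "((\<lambda>i. \<integral>x. G i x \<partial>M) has_sum (\<integral>x. F x \<partial>M)) A"
    by (subst (asm) has_sum_reindex_bij_betw[OF e])
qed

text \<open>The power series in \<open>z\<close> is integrated termwise, which avoids differentiation under the integral.\<close>

lemma holomorphic_exp_integral:
  fixes H :: "'a \<Rightarrow> complex" and x :: "'a \<Rightarrow> real"
  assumes [measurable]: "H \<in> borel_measurable M" "x \<in> borel_measurable M"
    and int: "\<And>r. integrable M (\<lambda>t. exp (r * x t) * norm (H t))"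
  shows "(\<lambda>z. \<integral>t. exp (z * of_real (x t)) * H t \<partial>M) holomorphic_on UNIV"
proof -
  define c where "c = (\<lambda>j :: nat. \<integral>t. (of_real (x t) ^ j / fact j) * H t \<partial>M)"
  have powser: "(\<lambda>j. c j * (z - 0) ^ j) sums (\<integral>t. exp (z * of_real (x t)) * H t \<partial>M)" for z
  proof -
    define G where "G = (\<lambda>j t. ((z * of_real (x t)) ^ j / fact j) * H t)"
    have nG: "norm (G j t) = (norm z * \<bar>x t\<bar>) ^ j / fact j * norm (H t)" for j t
      by (simp add: G_def norm_mult norm_divide norm_power)
    have bnd: "(\<Sum>j<n. norm (G j t)) \<le> exp (norm z * \<bar>x t\<bar>) * norm (H t)" for n t
    proof -
      have "(\<Sum>j<n. (norm z * \<bar>x t\<bar>) ^ j / fact j) \<le> exp (norm z * \<bar>x t\<bar>)"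
        unfolding sums_unique[OF exp_converges[of "norm z * \<bar>x t\<bar>"]]
        using sum_le_suminf[OF sums_summable[OF exp_converges[of "norm z * \<bar>x t\<bar>"]], of "{..<n}"]
        by (simp add: field_simps)
      thus ?thesis unfolding nG sum_distrib_right [symmetric] by (intro mult_right_mono) auto
    qed
    \<comment> \<open>This is the common majorant of all partial sums. The absolute value of
      \<open>x t\<close> is removed by adding the exponentials of both signs, which is why
      \<open>int\<close> is assumed for positive and negative \<open>r\<close>.\<close>
    have int_z: "integrable M (\<lambda>t. exp (norm z * \<bar>x t\<bar>) * norm (H t))"
    proof (rule Bochner_Integration.integrable_bound)
      show "integrable M (\<lambda>t. exp (norm z * x t) * norm (H t) + exp (- norm z * x t) * norm (H t))"
        by (intro Bochner_Integration.integrable_add int)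
      have "exp (norm z * \<bar>x t\<bar>) \<le> exp (norm z * x t) + exp (- norm z * x t)" for t
        by (cases "x t \<ge> 0") auto
      thus "AE t in M. norm (exp (norm z * \<bar>x t\<bar>) * norm (H t)) \<le>
          norm (exp (norm z * x t) * norm (H t) + exp (- norm z * x t) * norm (H t))"
        by (intro AE_I2) (simp add: mult_right_mono flip: distrib_right)
    qed measurable
    have intG: "integrable M (G j)" for j
    proof (rule Bochner_Integration.integrable_bound[OF int_z])
      show "G j \<in> borel_measurable M" unfolding G_def by measurable
      show "AE t in M. norm (G j t) \<le> norm (exp (norm z * \<bar>x t\<bar>) * norm (H t))"
      proof (rule AE_I2)
        fix t
        have "norm (G j t) \<le> (\<Sum>i<Suc j. norm (G i t))" by (simp add: sum_nonneg)
        also note bnd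
        finally show "norm (G j t) \<le> norm (exp (norm z * \<bar>x t\<bar>) * norm (H t))" by simp
      qed
    qed
    have "summable (\<lambda>j. \<integral>t. norm (G j t) \<partial>M)"
    proof (rule summableI_nonneg_bounded)
      fix n
      have "(\<Sum>j<n. \<integral>t. norm (G j t) \<partial>M) = (\<integral>t. (\<Sum>j<n. norm (G j t)) \<partial>M)"
        by (intro Bochner_Integration.integral_sum [symmetric] integrable_norm intG)
      also have "\<dots> \<le> (\<integral>t. exp (norm z * \<bar>x t\<bar>) * norm (H t) \<partial>M)"
        by (intro integral_mono Bochner_Integration.integrable_sum integrable_norm intG int_z bnd)
      finally show "(\<Sum>j<n. \<integral>t. norm (G j t) \<partial>M) \<le> (\<integral>t. exp (norm z * \<bar>x t\<bar>) * norm (H t) \<partial>M)" .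
    qed auto
    hence sm: "(\<lambda>j. \<integral>t. norm (G j t) \<partial>M) summable_on UNIV"
      by (intro norm_summable_imp_summable_on) simp
    have hs: "((\<lambda>j. G j t) has_sum exp (z * of_real (x t)) * H t) UNIV" for t
    proof -
      have "((\<lambda>j. (z * of_real (x t)) ^ j / fact j) has_sum exp (z * of_real (x t))) UNIV"
      proof (rule norm_summable_imp_has_sum)
        show "summable (\<lambda>j. norm ((z * of_real (x t)) ^ j / fact j))"
          using summable_norm_exp[of "z * of_real (x t)"] by (simp add: norm_divide norm_mult norm_power field_simps)
        show "(\<lambda>j. (z * of_real (x t)) ^ j / fact j) sums exp (z * of_real (x t))"
          using exp_converges[of "z * of_real (x t)"] by (simp add: scaleR_conv_of_real field_simps)
      qed
      thus ?thesis unfolding G_def by (rule has_sum_cmult_left)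
    qed
    have "((\<lambda>j. \<integral>t. G j t \<partial>M) has_sum (\<integral>t. exp (z * of_real (x t)) * H t \<partial>M)) UNIV"
      by (rule has_sum_integral(2)) (use intG sm hs in auto)
    hence "(\<lambda>j. \<integral>t. G j t \<partial>M) sums (\<integral>t. exp (z * of_real (x t)) * H t \<partial>M)"
      by (rule has_sum_imp_sums)
    moreover have "(\<integral>t. G j t \<partial>M) = c j * (z - 0) ^ j" for j
    proof -
      have "G j = (\<lambda>t. z ^ j * ((of_real (x t) ^ j / fact j) * H t))"
        by (simp add: G_def power_mult_distrib fun_eq_iff)
      thus ?thesis by (simp add: c_def)
    qed
    ultimately show ?thesis by simp
  qed
  have "(\<lambda>z. \<integral>t. exp (z * of_real (x t)) * H t \<partial>M) field_differentiable (at w)" for w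
  proof -
    have "(\<lambda>z. \<integral>t. exp (z * of_real (x t)) * H t \<partial>M) holomorphic_on ball 0 (norm w + 1)"
      using powser by (rule power_series_holomorphic)
    thus ?thesis by (rule holomorphic_on_imp_differentiable_at) auto
  qed
  thus ?thesis by (simp add: holomorphic_on_def)
qed

section \<open>Integrals of cusp forms along the imaginary axis\<close>

text \<open>Describes \<open>ordered_region\<close> by finitely many measurable inequalities, which
  are precisely the conditions under which no factor of \<open>gap_kernel\<close> is cut
  off.\<close>

definition pos_gaps :: "nat \<Rightarrow> (nat \<Rightarrow> real) \<Rightarrow> bool" where
  "pos_gaps n t \<longleftrightarrow> (\<forall>j\<in>{1..n}. gap t j > 0)"

lemma pos_gaps_strict_mono:
  assumes "pos_gaps n t" "1 \<le> i" "i < j" "j \<le> n"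
  shows "t i < t j"
  using assms(3,4)
proof (induction j)
  case (Suc j)
  have "t j < t (Suc j)"
    using assms(1) Suc.prems assms(2) by (auto simp: pos_gaps_def gap_def dest!: bspec[of _ _ "Suc j"])
  with Suc show ?case by (cases "i = j") auto
qed auto

lemma pos_gaps_pos:
  assumes "pos_gaps n t" "j \<in> {1..n}"
  shows "t j > 0" "gap t j > 0" "gap t j \<le> t j"
proof -
  have 1: "t 1 > 0" using assms by (auto simp: pos_gaps_def gap_def dest!: bspec[of _ _ 1])
  have pos: "t i > 0" if "i \<in> {1..n}" for i
    using 1 pos_gaps_strict_mono[OF assms(1), of 1 i] that by (cases "i = 1") auto
  show "t j > 0" by (rule pos[OF assms(2)])
  show "gap t j > 0" using assms by (simp add: pos_gaps_def)
  show "gap t j \<le> t j"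
  proof (cases "j \<le> 1")
    case False
    hence "t (j - 1) > 0" using assms(2) by (intro pos) auto
    with False show ?thesis by (simp add: gap_def)
  qed (simp add: gap_def)
qed

lemma ordered_region_iff:
  assumes "t \<in> space (Pi\<^sub>M {1..n} (\<lambda>_. lborel))"
  shows "t \<in> ordered_region n \<longleftrightarrow> pos_gaps n t"
proof
  assume t: "t \<in> ordered_region n"
  have "gap t j > 0" if j: "j \<in> {1..n}" for j
  proof (cases "j \<le> 1")
    case True
    with t j show ?thesis by (auto simp: ordered_region_def gap_def PiE_iff)
  next
    case False
    have "strict_mono_on {1..n} t" using t by (simp add: ordered_region_def)
    moreover have "j - 1 \<in> {1..n}" "j - 1 < j" using j False by auto
    ultimately have "t (j - 1) < t j" using j by (intro strict_mono_onD[of "{1..n}" t])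
    with False show ?thesis by (simp add: gap_def)
  qed
  thus "pos_gaps n t" by (simp add: pos_gaps_def)
next
  assume t: "pos_gaps n t"
  have "t \<in> extensional {1..n}" using assms by (simp add: space_PiM PiE_def)
  moreover have "strict_mono_on {1..n} t"
    by (rule strict_mono_onI, rule pos_gaps_strict_mono[OF t]) auto
  ultimately show "t \<in> ordered_region n"
    using pos_gaps_pos(1)[OF t] by (simp add: ordered_region_def PiE_iff)
qed

lemma measurable_pos_gaps [measurable]:
  "Measurable.pred (Pi\<^sub>M {1..n} (\<lambda>_. lborel)) (pos_gaps n)"
  unfolding pos_gaps_def
proof (rule pred_intros_finite(3))
  fix j assume "j \<in> {1..n}"
  thus "Measurable.pred (Pi\<^sub>M {1..n} (\<lambda>_. lborel)) (\<lambda>t. gap t j > (0 :: real))"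
    unfolding pred_def by (intro borel_measurable_less borel_measurable_const borel_measurable_component_gap(2))
qed auto

text \<open>The values of \<open>f\<close> outside the upper half-plane are unconstrained; extension
  by 0 gives a Borel function on the whole line.\<close>

definition axis_val :: "(complex \<Rightarrow> complex) \<Rightarrow> real \<Rightarrow> complex" where
  "axis_val f u = (if u > 0 then f (\<i> * of_real u) else 0)"

lemma borel_measurable_axis:
  assumes "cusp_form k f"
  shows "axis_val f \<in> borel_measurable borel"
proof -
  have "f holomorphic_on {z. Im z > 0}" using assms by (simp add: cusp_form_def)
  hence "continuous_on {0<..} (\<lambda>u::real. f (\<i> * of_real u))"
    by (intro continuous_on_compose2[OF holomorphic_on_imp_continuous_on, of f "{z. Im z > 0}"])
       (auto intro!: continuous_intros)
  hence "(\<lambda>u. if u \<in> {0<..} then f (\<i> * of_real u) else 0) \<in> borel_measurable (borel :: real measure)"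
    by (intro borel_measurable_continuous_on_if) auto
  thus ?thesis by (simp add: axis_val_def [abs_def])
qed

lemma integrable_axis_powr:
  assumes "cusp_form k f"
  shows "integrable lborel (\<lambda>u. norm (axis_val f u) * u powr r)"
proof -
  obtain C where C: "C \<ge> 0"
    "\<And>t. t > 0 \<Longrightarrow> norm (f (\<i> * of_real t)) * t powr r \<le> C * exp (- t)"
    using cusp_form_imaginary_axis_decay[OF assms] by blast
  note [measurable] = borel_measurable_axis[OF assms]
  \<comment> \<open>The majorant \<open>exp (- y)\<close> on the positive axis, written as the Gamma
    integrand with \<open>s = 1\<close>, \<open>a = 1\<close>, \<open>c = 0\<close> to obtain its
    integrability.\<close>
  define e where "e = (\<lambda>y. if y > 0 then complex_of_real (y - 0) powr (1 - 1) * of_real (exp (- 1 * y)) else 0)"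
  have "integrable lborel e"
    unfolding e_def using has_bochner_integral_Gamma[of 1 1 0] by (auto simp: has_bochner_integral_iff)
  hence "integrable lborel (\<lambda>y. C * norm (e y))" by (intro integrable_mult_right integrable_norm)
  thus ?thesis
  proof (rule Bochner_Integration.integrable_bound)
    show "AE u in lborel. norm (norm (axis_val f u) * u powr r) \<le> norm (C * norm (e u))"
      using C by (intro AE_I2) (auto simp: axis_val_def e_def norm_mult)
  qed measurable
qed

text \<open>Common criterion for both integrands: a weight dominated by powers of the single
  \<open>t j\<close> leaves a product of one-variable functions, each integrable for every real
  exponent by the decay of \<open>f j\<close> at 0 and at infinity.\<close>

lemma integrable_pos_gaps:
  fixes w :: "(nat \<Rightarrow> real) \<Rightarrow> complex"
  assumes f: "\<And>j. j \<in> {1..n} \<Longrightarrow> cusp_form (k j) (f j)"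
    and [measurable]: "w \<in> borel_measurable (Pi\<^sub>M {1..n} (\<lambda>_. lborel))"
    and w: "\<And>t. pos_gaps n t \<Longrightarrow> norm (w t) \<le> (\<Prod>j=1..n. t j powr r j)"
  shows "integrable (Pi\<^sub>M {1..n} (\<lambda>_. lborel)) (\<lambda>t. if pos_gaps n t then (\<Prod>j=1..n. axis_val (f j) (t j)) * w t else 0)"
proof (rule Bochner_Integration.integrable_bound)
  show "integrable (Pi\<^sub>M {1..n} (\<lambda>_. lborel)) (\<lambda>t. \<Prod>j=1..n. norm (axis_val (f j) (t j)) * t j powr r j)"
    by (intro lborel_product.product_integrable_prod finite_atLeastAtMost) (rule integrable_axis_powr[OF f])
  have [measurable]: "(\<lambda>t. \<Prod>j=1..n. axis_val (f j) (t j)) \<in> borel_measurable (Pi\<^sub>M {1..n} (\<lambda>_. lborel))"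
  proof (rule borel_measurable_prod)
    fix j assume j: "j \<in> {1..n}"
    show "(\<lambda>t. axis_val (f j) (t j)) \<in> borel_measurable (Pi\<^sub>M {1..n} (\<lambda>_. lborel))"
      by (rule measurable_compose[OF borel_measurable_component_gap(1)[OF j] borel_measurable_axis[OF f[OF j]]])
  qed
  show "(\<lambda>t. if pos_gaps n t then (\<Prod>j=1..n. axis_val (f j) (t j)) * w t else 0)
      \<in> borel_measurable (Pi\<^sub>M {1..n} (\<lambda>_. lborel))" by measurable
  have "norm (if pos_gaps n t then (\<Prod>j=1..n. axis_val (f j) (t j)) * w t else 0) \<le>
      (\<Prod>j=1..n. norm (axis_val (f j) (t j)) * t j powr r j)" for t
  proof (cases "pos_gaps n t")
    case True
    have "norm ((\<Prod>j=1..n. axis_val (f j) (t j)) * w t) \<le> (\<Prod>j=1..n. norm (axis_val (f j) (t j))) * (\<Prod>j=1..n. t j powr r j)"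
      unfolding norm_mult prod_norm [symmetric] by (intro mult_left_mono w True prod_nonneg) auto
    with True show ?thesis by (simp add: prod.distrib)
  qed (auto intro!: prod_nonneg)
  moreover have "(\<Prod>j=1..n. norm (axis_val (f j) (t j)) * t j powr r j) \<ge> 0" for t :: "nat \<Rightarrow> real"
    by (intro prod_nonneg) auto
  ultimately show "AE t in Pi\<^sub>M {1..n} (\<lambda>_. lborel). norm (if pos_gaps n t then (\<Prod>j=1..n. axis_val (f j) (t j)) * w t else 0)
     \<le> norm (\<Prod>j=1..n. norm (axis_val (f j) (t j)) * t j powr r j)"
    by (intro AE_I2) (simp add: abs_of_nonneg)
qed

definition gap_integrand ::
    "nat \<Rightarrow> (nat \<Rightarrow> complex \<Rightarrow> complex) \<Rightarrow> (nat \<Rightarrow> complex) \<Rightarrow> (nat \<Rightarrow> real) \<Rightarrow> complex" where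
  "gap_integrand n f s t = (if pos_gaps n t
     then (\<Prod>j=1..n. axis_val (f j) (t j)) * (\<Prod>j=1..n. of_real (gap t j) powr (s j - 1)) else 0)"

text \<open>For \<open>j \<ge> 2\<close>, \<open>Re (s j) \<ge> 1\<close> allows the gap to be
  replaced by the larger \<open>t j\<close>. For \<open>j = 1\<close> the two coincide, so
  \<open>s 1\<close> is unrestricted.\<close>

lemma integrable_gap_integrand:
  assumes f: "\<And>j. j \<in> {1..n} \<Longrightarrow> cusp_form (k j) (f j)"
    and s: "\<And>j. j \<in> {2..n} \<Longrightarrow> Re (s j) \<ge> 1"
  shows "integrable (Pi\<^sub>M {1..n} (\<lambda>_. lborel)) (gap_integrand n f s)"
proof -
  have "integrable (Pi\<^sub>M {1..n} (\<lambda>_. lborel)) (\<lambda>t. if pos_gaps n t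
     then (\<Prod>j=1..n. axis_val (f j) (t j)) * (\<Prod>j=1..n. of_real (gap t j) powr (s j - 1)) else 0)"
  proof (rule integrable_pos_gaps[of n k f _ "\<lambda>j. Re (s j) - 1"])
    show "(\<lambda>t. \<Prod>j=1..n. complex_of_real (gap t j) powr (s j - 1)) \<in> borel_measurable (Pi\<^sub>M {1..n} (\<lambda>_. lborel))"
      by (intro borel_measurable_prod borel_measurable_complex_powr borel_measurable_component_gap(2))
    fix t assume t: "pos_gaps n t"
    have "norm (complex_of_real (gap t j) powr (s j - 1)) \<le> t j powr (Re (s j) - 1)" if j: "j \<in> {1..n}" for j
    proof -
      note pos = pos_gaps_pos[OF t j]
      have "norm (complex_of_real (gap t j) powr (s j - 1)) = gap t j powr (Re (s j) - 1)"
        using pos by (subst norm_powr_real_powr) auto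
      also have "\<dots> \<le> t j powr (Re (s j) - 1)"
      proof (cases "j = 1")
        case False
        hence "Re (s j) \<ge> 1" using j by (intro s) auto
        thus ?thesis using pos by (intro powr_mono2) auto
      qed (simp add: gap_def)
      finally show ?thesis .
    qed
    thus "norm (\<Prod>j=1..n. complex_of_real (gap t j) powr (s j - 1)) \<le> (\<Prod>j=1..n. t j powr (Re (s j) - 1))"
      unfolding prod_norm [symmetric] by (intro prod_mono) auto
  qed (rule f)
  thus ?thesis by (simp add: gap_integrand_def [abs_def])
qed

lemma Lambda_integrand_region:
  assumes "t \<in> space (Pi\<^sub>M {1..n} (\<lambda>_. lborel))"
  shows "indicator (ordered_region n) t *\<^sub>R mLambda_integrand n f s t = (if pos_gaps n t
     then (\<Prod>j=1..n. axis_val (f j) (t j)) * (\<Prod>j=1..n. of_real (t j) powr (s j - 1)) else 0)"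
proof (cases "pos_gaps n t")
  case True
  have "(\<Prod>j=1..n. axis_val (f j) (t j)) = (\<Prod>j=1..n. f j (\<i> * of_real (t j)))"
    using pos_gaps_pos(1)[OF True] by (intro prod.cong) (auto simp: axis_val_def)
  with True assms show ?thesis
    by (simp add: ordered_region_iff mLambda_integrand_def prod.distrib)
qed (use assms in \<open>simp add: ordered_region_iff\<close>)

lemma integrable_Lambda_integrand:
  assumes f: "\<And>j. j \<in> {1..n} \<Longrightarrow> cusp_form (k j) (f j)"
  shows "set_integrable (Pi\<^sub>M {1..n} (\<lambda>_. lborel)) (ordered_region n) (mLambda_integrand n f s)"
proof -
  have "integrable (Pi\<^sub>M {1..n} (\<lambda>_. lborel)) (\<lambda>t. if pos_gaps n t
     then (\<Prod>j=1..n. axis_val (f j) (t j)) * (\<Prod>j=1..n. of_real (t j) powr (s j - 1)) else 0)"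
  proof (rule integrable_pos_gaps[of n k f _ "\<lambda>j. Re (s j) - 1"])
    show "(\<lambda>t. \<Prod>j=1..n. complex_of_real (t j) powr (s j - 1)) \<in> borel_measurable (Pi\<^sub>M {1..n} (\<lambda>_. lborel))"
      by (intro borel_measurable_prod borel_measurable_complex_powr borel_measurable_component_gap(1))
    fix t assume t: "pos_gaps n t"
    have "norm (complex_of_real (t j) powr (s j - 1)) = t j powr (Re (s j) - 1)" if "j \<in> {1..n}" for j
      using pos_gaps_pos(1)[OF t that] by (subst norm_powr_real_powr) auto
    thus "norm (\<Prod>j=1..n. complex_of_real (t j) powr (s j - 1)) \<le> (\<Prod>j=1..n. t j powr (Re (s j) - 1))"
      unfolding prod_norm [symmetric] by (intro prod_mono) auto
  qed (rule f)
  thus ?thesis unfolding set_integrable_def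
    by (subst Bochner_Integration.integrable_cong[OF refl Lambda_integrand_region])
qed

text \<open>\<open>s 1\<close> enters only through a power of \<open>t 1\<close>, which is
  \<open>exp (z * ln (t 1))\<close> times a factor free of \<open>z\<close>. The integral is
  therefore of the exponential type treated in \<open>holomorphic_exp_integral\<close>.\<close>

lemma holomorphic_gap_integral:
  assumes n: "n \<ge> 1" and f: "\<And>j. j \<in> {1..n} \<Longrightarrow> cusp_form (k j) (f j)"
    and s: "\<And>j. j \<in> {2..n} \<Longrightarrow> Re (s j) \<ge> 1"
  shows "(\<lambda>z. \<integral>t. gap_integrand n f (s(1 := z)) t \<partial>Pi\<^sub>M {1..n} (\<lambda>_. lborel)) holomorphic_on UNIV"
proof -
  have split: "gap_integrand n f (s(1 := z)) t =
      exp (z * of_real (ln (t 1))) * gap_integrand n f (s(1 := 0)) t" for z t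
  proof (cases "pos_gaps n t")
    case True
    have t1: "t 1 > 0" "gap t 1 = t 1" using pos_gaps_pos(1)[OF True, of 1] n by (auto simp: gap_def)
    have *: "complex_of_real (t 1) powr (z - 1) = exp (z * of_real (ln (t 1))) * of_real (t 1) powr (0 - 1)"
      using t1 by (simp add: powr_def Ln_of_real algebra_simps flip: exp_add)
    have "(\<Prod>j=1..n. complex_of_real (gap t j) powr ((s(1 := z)) j - 1)) =
        exp (z * of_real (ln (t 1))) * (\<Prod>j=1..n. complex_of_real (gap t j) powr ((s(1 := 0)) j - 1))"
    proof -
      have ins: "{1..n} = insert 1 {2..n}" using n by auto
      have "(\<Prod>j=2..n. complex_of_real (gap t j) powr ((s(1 := z)) j - 1)) =
          (\<Prod>j=2..n. complex_of_real (gap t j) powr ((s(1 := 0)) j - 1))"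
        by (intro prod.cong) auto
      thus ?thesis unfolding ins using * t1 by simp
    qed
    with True show ?thesis by (simp add: gap_integrand_def)
  qed (simp add: gap_integrand_def)
  have m1 [measurable]: "(\<lambda>t. t 1) \<in> borel_measurable (Pi\<^sub>M {1..n} (\<lambda>_. lborel :: real measure))"
    using n by (intro borel_measurable_component_gap) auto
  have int: "integrable (Pi\<^sub>M {1..n} (\<lambda>_. lborel)) (gap_integrand n f (s(1 := z)))" for z
    using s by (intro integrable_gap_integrand[of n k f] f) auto
  have "(\<lambda>z. \<integral>t. exp (z * of_real (ln (t 1))) * gap_integrand n f (s(1 := 0)) t \<partial>Pi\<^sub>M {1..n} (\<lambda>_. lborel))
      holomorphic_on UNIV"
  proof (rule holomorphic_exp_integral)
    show "gap_integrand n f (s(1 := 0)) \<in> borel_measurable (Pi\<^sub>M {1..n} (\<lambda>_. lborel))"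
      using int by (rule borel_measurable_integrable)
    fix r :: real
    \<comment> \<open>The weight \<open>exp (r * ln (t 1))\<close> merely moves the first exponent
      to \<open>r\<close>, where integrability is already known.\<close>
    have "norm (gap_integrand n f (s(1 := of_real r)) t) = exp (r * ln (t 1)) * norm (gap_integrand n f (s(1 := 0)) t)" for t
      by (subst split) (simp add: norm_mult)
    thus "integrable (Pi\<^sub>M {1..n} (\<lambda>_. lborel)) (\<lambda>t. exp (r * ln (t 1)) * norm (gap_integrand n f (s(1 := 0)) t))"
      using integrable_norm[OF int[of "of_real r"]] by simp
  qed measurable
  thus ?thesis by (subst split)
qed

section \<open>The multiple Dirichlet series\<close>

lemma has_sum_prod_PiE:
  fixes g :: "'a \<Rightarrow> 'b \<Rightarrow> complex"
  assumes A: "finite A" and B: "\<And>x. x \<in> A \<Longrightarrow> countable (B x)"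
    and hs: "\<And>x. x \<in> A \<Longrightarrow> (g x has_sum S x) (B x)"
  shows "((\<lambda>h. \<Prod>x\<in>A. g x (h x)) has_sum (\<Prod>x\<in>A. S x)) (PiE A B)"
proof -
  have sm: "Infinite_Sum.abs_summable_on (g x) (B x)" if "x \<in> A" for x
    using has_sum_imp_summable[OF hs[OF that]] by (simp only: summable_on_iff_abs_summable_on_complex)
  have "Infinite_Sum.abs_summable_on (\<lambda>h. \<Prod>x\<in>A. g x (h x)) (PiE A B)"
    using A B sm unfolding abs_summable_equivalent by (intro abs_summable_on_prod_PiE)
  hence "(\<lambda>h. \<Prod>x\<in>A. g x (h x)) summable_on (PiE A B)"
    by (simp only: summable_on_iff_abs_summable_on_complex)
  moreover have "infsum (\<lambda>h. \<Prod>x\<in>A. g x (h x)) (PiE A B) = (\<Prod>x\<in>A. S x)"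
    using infsum_prod_PiE_abs[OF A sm] infsumI[OF hs] by simp
  ultimately show ?thesis by (metis has_sum_infsum)
qed

lemma mL_indices_pos: "l \<in> mL_indices n \<Longrightarrow> j \<in> {1..n} \<Longrightarrow> l j > 0"
  by (auto simp: mL_indices_def PiE_iff)

lemma mL_indices_tail_ge: "j \<in> {1..n} \<Longrightarrow> (\<Sum>i=j..n. l i) \<ge> l j" for l :: "nat \<Rightarrow> nat"
  by (intro member_le_sum) auto

lemma countable_mL_indices: "countable (mL_indices n)"
  unfolding mL_indices_def by (intro countable_PiE) auto

text \<open>The constant tuples already form an infinite family. Infinitude is needed because
  \<open>has_sum_integral\<close> enumerates its index set by all natural numbers.\<close>

lemma infinite_mL_indices:
  assumes "n \<ge> 1"
  shows "infinite (mL_indices n)"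
proof
  assume "finite (mL_indices n)"
  moreover have "inj_on (\<lambda>c. \<lambda>j\<in>{1..n}. c) {0::nat<..}"
    using assms by (intro inj_onI) (auto dest!: fun_cong[of _ _ 1])
  moreover have "(\<lambda>c. \<lambda>j\<in>{1..n}. c) ` {0::nat<..} \<subseteq> mL_indices n"
    by (auto simp: mL_indices_def)
  ultimately have "finite {0::nat<..}" by (meson finite_subset finite_imageD)
  thus False by (simp add: infinite_Ioi)
qed

definition Gamma_factor :: "nat \<Rightarrow> (nat \<Rightarrow> complex) \<Rightarrow> complex" where
  "Gamma_factor n s = (\<Prod>j=1..n. Gamma (s j)) / of_real (2 * pi) powr (\<Sum>j=1..n. s j)"

lemma Gamma_factor_nonzero:
  assumes "\<And>j. j \<in> {1..n} \<Longrightarrow> Re (s j) > 0"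
  shows "Gamma_factor n s \<noteq> 0"
proof -
  have "s j \<notin> \<int>\<^sub>\<le>\<^sub>0" if "j \<in> {1..n}" for j
    using assms[OF that] by (auto elim!: nonpos_Ints_cases)
  thus ?thesis by (auto simp: Gamma_factor_def Gamma_eq_zero_iff)
qed

lemma Gamma_factor_prod:
  "Gamma_factor n s = (\<Prod>j=1..n. Gamma (s j) / of_real (2 * pi) powr s j)"
  by (simp add: Gamma_factor_def prod_dividef powr_def sum_distrib_right exp_sum)

text \<open>The tail sums of \<open>2 * pi * l i\<close> are \<open>2 * pi\<close> times the bases
  in the Dirichlet denominator. The second part shows the L1 norms to be a fixed multiple of the
  moduli of the terms.\<close>

lemma mL_term_integral:
  assumes l: "l \<in> mL_indices n" and s: "\<And>j. j \<in> {1..n} \<Longrightarrow> Re (s j) > 0"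
  shows "(\<Prod>j=1..n. fourier_coeff (f j) (l j)) *
      (\<integral>t. gap_kernel n s (\<lambda>j. 2 * pi * real (l j)) t \<partial>Pi\<^sub>M {1..n} (\<lambda>_. lborel)) =
    Gamma_factor n s * mL_term n f s l"
    and "norm (\<Prod>j=1..n. fourier_coeff (f j) (l j)) *
      (\<integral>t. norm (gap_kernel n s (\<lambda>j. 2 * pi * real (l j)) t) \<partial>Pi\<^sub>M {1..n} (\<lambda>_. lborel)) =
    (\<Prod>j=1..n. Gamma (Re (s j)) / (2 * pi) powr Re (s j)) * norm (mL_term n f s l)"
proof -
  define L where "L = (\<lambda>j. \<Sum>i=j..n. l i)"
  have L: "L j > 0" if "j \<in> {1..n}" for j
    using mL_indices_tail_ge[OF that, of l] mL_indices_pos[OF l that] by (simp add: L_def)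
  have sumL: "(\<Sum>i=j..n. 2 * pi * real (l i)) = 2 * pi * real (L j)" for j
    by (simp add: L_def sum_distrib_left)
  have pos: "2 * pi * real (l j) > 0" if "j \<in> {1..n}" for j
    using mL_indices_pos[OF l that] by simp
  have "(\<integral>t. gap_kernel n s (\<lambda>j. 2 * pi * real (l j)) t \<partial>Pi\<^sub>M {1..n} (\<lambda>_. lborel)) =
      (\<Prod>j=1..n. Gamma (s j) / of_real (2 * pi * real (L j)) powr s j)"
    using integral_gap_kernel[of n s "\<lambda>j. 2 * pi * real (l j)"] s pos by (simp only: sumL)
  also have "\<dots> = (\<Prod>j=1..n. Gamma (s j) / of_real (2 * pi) powr s j / of_nat (L j) powr s j)"
  proof (intro prod.cong refl)
    fix j assume "j \<in> {1..n}"
    have "of_real (2 * pi * real (L j)) powr s j = of_real (2 * pi) powr s j * of_real (real (L j)) powr s j"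
      unfolding of_real_mult[of "2 * pi"] by (rule powr_times_real) auto
    thus "Gamma (s j) / of_real (2 * pi * real (L j)) powr s j =
        Gamma (s j) / of_real (2 * pi) powr s j / of_nat (L j) powr s j"
      by (simp only: of_real_of_nat_eq divide_divide_eq_left)
  qed
  also have "\<dots> = Gamma_factor n s / (\<Prod>j=1..n. of_nat (L j) powr s j)"
    unfolding Gamma_factor_prod by (rule prod_dividef)
  finally show "(\<Prod>j=1..n. fourier_coeff (f j) (l j)) *
      (\<integral>t. gap_kernel n s (\<lambda>j. 2 * pi * real (l j)) t \<partial>Pi\<^sub>M {1..n} (\<lambda>_. lborel)) =
    Gamma_factor n s * mL_term n f s l"
    by (simp add: mL_term_def L_def)
  have "(\<integral>t. norm (gap_kernel n s (\<lambda>j. 2 * pi * real (l j)) t) \<partial>Pi\<^sub>M {1..n} (\<lambda>_. lborel)) =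
      (\<Prod>j=1..n. Gamma (Re (s j)) / (2 * pi * real (L j)) powr Re (s j))"
    using integral_norm_gap_kernel[of n s "\<lambda>j. 2 * pi * real (l j)"] s pos by (simp only: sumL)
  also have "\<dots> = (\<Prod>j=1..n. Gamma (Re (s j)) / (2 * pi) powr Re (s j) / norm (of_nat (L j) powr s j))"
  proof (intro prod.cong refl)
    fix j assume "j \<in> {1..n}"
    have "norm (complex_of_nat (L j) powr s j) = real (L j) powr Re (s j)"
      by (subst norm_powr_real_powr) auto
    thus "Gamma (Re (s j)) / (2 * pi * real (L j)) powr Re (s j) =
        Gamma (Re (s j)) / (2 * pi) powr Re (s j) / norm (of_nat (L j) powr s j)"
      by (simp add: powr_mult)
  qed
  also have "\<dots> = (\<Prod>j=1..n. Gamma (Re (s j)) / (2 * pi) powr Re (s j)) / norm (\<Prod>j=1..n. of_nat (L j) powr s j)"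
    by (simp only: prod_dividef prod_norm)
  finally show "norm (\<Prod>j=1..n. fourier_coeff (f j) (l j)) *
      (\<integral>t. norm (gap_kernel n s (\<lambda>j. 2 * pi * real (l j)) t) \<partial>Pi\<^sub>M {1..n} (\<lambda>_. lborel)) =
    (\<Prod>j=1..n. Gamma (Re (s j)) / (2 * pi) powr Re (s j)) * norm (mL_term n f s l)"
    by (simp add: mL_term_def L_def norm_divide)
qed

text \<open>On increasing positive tuples this is the product of the Fourier expansions at the
  points \<open>\<i> * t j\<close>; elsewhere some factor of the kernel and the integrand both
  vanish.\<close>

lemma has_sum_gap_kernel:
  assumes f: "\<And>j. j \<in> {1..n} \<Longrightarrow> cusp_form (k j) (f j)"
  shows "((\<lambda>l. (\<Prod>j=1..n. fourier_coeff (f j) (l j)) * gap_kernel n s (\<lambda>j. 2 * pi * real (l j)) t)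
            has_sum gap_integrand n f s t) (mL_indices n)"
proof (cases "pos_gaps n t")
  case True
  have "((\<lambda>l. \<Prod>j=1..n. fourier_coeff (f j) (l j) * of_real (exp (- (2 * pi * real (l j)) * t j)))
      has_sum (\<Prod>j=1..n. axis_val (f j) (t j))) (PiE {1..n} (\<lambda>_. {0<..}))"
  proof (rule has_sum_prod_PiE)
    fix j assume j: "j \<in> {1..n}"
    have t: "t j > 0" by (rule pos_gaps_pos(1)[OF True j])
    have "((\<lambda>l. fourier_coeff (f j) l * exp (2 * \<i> * of_real pi * of_nat l * (\<i> * of_real (t j))))
        has_sum f j (\<i> * of_real (t j))) {0<..}"
      using cusp_form_expansion[OF f[OF j]] t by (simp add: has_cusp_expansion_def)
    moreover have "exp (2 * \<i> * of_real pi * of_nat l * (\<i> * of_real (t j))) =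
        complex_of_real (exp (- (2 * pi * real l) * t j))" for l
    proof -
      have "2 * \<i> * of_real pi * of_nat l * (\<i> * of_real (t j)) = complex_of_real (- (2 * pi * real l) * t j)"
        by (simp add: algebra_simps)
      thus ?thesis by (simp only: exp_of_real)
    qed
    ultimately show "((\<lambda>l. fourier_coeff (f j) l * of_real (exp (- (2 * pi * real l) * t j)))
        has_sum axis_val (f j) (t j)) {0<..}"
      using t by (simp add: axis_val_def)
  qed auto
  hence "((\<lambda>l. (\<Prod>j=1..n. fourier_coeff (f j) (l j) * of_real (exp (- (2 * pi * real (l j)) * t j))) *
        (\<Prod>j=1..n. of_real (gap t j) powr (s j - 1))) has_sum gap_integrand n f s t) (mL_indices n)"
    using True unfolding mL_indices_def gap_integrand_def by (simp only: if_True has_sum_cmult_left)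
  moreover have "(\<Prod>j=1..n. fourier_coeff (f j) (l j) * of_real (exp (- (2 * pi * real (l j)) * t j))) *
        (\<Prod>j=1..n. of_real (gap t j) powr (s j - 1)) =
        (\<Prod>j=1..n. fourier_coeff (f j) (l j)) * gap_kernel n s (\<lambda>j. 2 * pi * real (l j)) t" for l
  proof -
    have "gap_kernel n s (\<lambda>j. 2 * pi * real (l j)) t =
        (\<Prod>j=1..n. complex_of_real (gap t j) powr (s j - 1) * of_real (exp (- (2 * pi * real (l j)) * t j)))"
      unfolding gap_kernel_def using pos_gaps_pos(2)[OF True] by (intro prod.cong) auto
    thus ?thesis by (simp only: prod.distrib mult_ac)
  qed
  ultimately show ?thesis by simp
next
  case False
  then obtain j where "j \<in> {1..n}" "\<not> gap t j > 0" by (auto simp: pos_gaps_def)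
  hence "gap_kernel n s \<mu> t = 0" for \<mu> unfolding gap_kernel_def by (intro prod_zero) auto
  with False show ?thesis by (simp add: gap_integrand_def)
qed

text \<open>Termwise integration of the Dirichlet series; absolute convergence of the series is exactly
  what the interchange needs.\<close>

lemma has_sum_mL_term:
  assumes n: "n \<ge> 1" and f: "\<And>j. j \<in> {1..n} \<Longrightarrow> cusp_form (k j) (f j)"
    and s: "\<And>j. j \<in> {1..n} \<Longrightarrow> Re (s j) > 0"
    and sm: "mL_term n f s summable_on mL_indices n"
  shows "(mL_term n f s has_sum (\<integral>t. gap_integrand n f s t \<partial>Pi\<^sub>M {1..n} (\<lambda>_. lborel)) / Gamma_factor n s) (mL_indices n)"
proof -
  define G where "G = (\<lambda>l t. (\<Prod>j=1..n. fourier_coeff (f j) (l j)) * gap_kernel n s (\<lambda>j. 2 * pi * real (l j)) t)"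
  have "((\<lambda>l. \<integral>t. G l t \<partial>Pi\<^sub>M {1..n} (\<lambda>_. lborel)) has_sum
      (\<integral>t. gap_integrand n f s t \<partial>Pi\<^sub>M {1..n} (\<lambda>_. lborel))) (mL_indices n)"
  proof (rule has_sum_integral(2))
    show "integrable (Pi\<^sub>M {1..n} (\<lambda>_. lborel)) (G l)" if l: "l \<in> mL_indices n" for l
      unfolding G_def using s mL_indices_pos[OF l]
      by (intro integrable_mult_right integrable_gap_kernel) auto
    have "(\<lambda>l. (\<Prod>j=1..n. Gamma (Re (s j)) / (2 * pi) powr Re (s j)) * norm (mL_term n f s l)) summable_on mL_indices n"
      using sm by (intro summable_on_cmult_right) (simp only: summable_on_iff_abs_summable_on_complex)
    moreover have "(\<integral>t. norm (G l t) \<partial>Pi\<^sub>M {1..n} (\<lambda>_. lborel)) =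
        (\<Prod>j=1..n. Gamma (Re (s j)) / (2 * pi) powr Re (s j)) * norm (mL_term n f s l)" if "l \<in> mL_indices n" for l
      using mL_term_integral(2)[OF that s, where f = f] by (simp add: G_def norm_mult)
    ultimately show "(\<lambda>l. \<integral>t. norm (G l t) \<partial>Pi\<^sub>M {1..n} (\<lambda>_. lborel)) summable_on mL_indices n"
      by (subst summable_on_cong)
    show "((\<lambda>l. G l t) has_sum gap_integrand n f s t) (mL_indices n)" for t
      unfolding G_def by (rule has_sum_gap_kernel[OF f])
  qed (use countable_mL_indices infinite_mL_indices[OF n] in auto)
  moreover have "(\<integral>t. G l t \<partial>Pi\<^sub>M {1..n} (\<lambda>_. lborel)) = Gamma_factor n s * mL_term n f s l"
    if "l \<in> mL_indices n" for l
    using mL_term_integral(1)[OF that s, where f = f] by (simp add: G_def)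
  ultimately have "((\<lambda>l. Gamma_factor n s * mL_term n f s l) has_sum
      (\<integral>t. gap_integrand n f s t \<partial>Pi\<^sub>M {1..n} (\<lambda>_. lborel))) (mL_indices n)"
    by (subst (asm) has_sum_cong)
  hence "((\<lambda>l. inverse (Gamma_factor n s) * (Gamma_factor n s * mL_term n f s l)) has_sum
      inverse (Gamma_factor n s) * (\<integral>t. gap_integrand n f s t \<partial>Pi\<^sub>M {1..n} (\<lambda>_. lborel))) (mL_indices n)"
    by (rule has_sum_cmult_right)
  thus ?thesis using Gamma_factor_nonzero[OF s] by (simp add: field_simps)
qed

text \<open>The first base is at least every \<open>l j\<close>, so its power with exponent
  \<open>n * K\<close> dominates the product of all \<open>l j ^ K\<close>; the other denominators
  have modulus at least 1. The choice of \<open>K\<close> leaves at most a constant times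
  \<open>1 / l j ^ 2\<close> for each coefficient, even after its growth
  \<open>l j ^ k j\<close>.\<close>

lemma summable_mL_term:
  assumes n: "n \<ge> 1" and f: "\<And>j. j \<in> {1..n} \<Longrightarrow> cusp_form (k j) (f j)"
    and s: "\<And>j. j \<in> {2..n} \<Longrightarrow> Re (s j) \<ge> 0" "Re (s 1) \<ge> real (n * (2 + (\<Sum>j=1..n. k j)))"
  shows "mL_term n f s summable_on mL_indices n"
proof -
  define K where "K = 2 + (\<Sum>j=1..n. k j)"
  have K: "k j + 2 \<le> K" if "j \<in> {1..n}" for j
    using member_le_sum[of j "{1..n}" k] that by (simp add: K_def)
  have "\<forall>j\<in>{1..n}. \<exists>C\<ge>0. \<forall>l>0. norm (fourier_coeff (f j) l) \<le> C * real l ^ k j"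
    using cusp_form_fourier_coeff_bound[OF f] by metis
  then obtain C where C: "\<And>j. j \<in> {1..n} \<Longrightarrow> C j \<ge> 0"
    "\<And>j l. j \<in> {1..n} \<Longrightarrow> l > 0 \<Longrightarrow> norm (fourier_coeff (f j) l) \<le> C j * real l ^ k j"
    by (metis (no_types))
  have C2: "norm (fourier_coeff (f j) l) / real l ^ K \<le> C j / real l ^ 2" if j: "j \<in> {1..n}" and l: "l > 0" for j l
  proof -
    have "norm (fourier_coeff (f j) l) * real l ^ 2 \<le> C j * (real l ^ k j * real l ^ 2)"
      using mult_right_mono[OF C(2)[OF j l], of "real l ^ 2"] by (simp add: mult.assoc)
    also have "\<dots> \<le> C j * real l ^ K"
      unfolding power_add [symmetric] using K[OF j] l C(1)[OF j]
      by (intro mult_left_mono power_increasing) auto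
    finally show ?thesis using l by (simp add: field_simps)
  qed
  have "((\<lambda>l. complex_of_real (C j / real l ^ 2)) summable_on {0<..})" for j
  proof -
    have "summable (\<lambda>l. \<bar>C j\<bar> * inverse (real l ^ 2))"
      by (intro summable_mult inverse_power_summable) auto
    moreover have "norm (complex_of_real (C j / real l ^ 2)) = \<bar>C j\<bar> * inverse (real l ^ 2)" for l
      unfolding norm_of_real by (simp add: divide_inverse abs_mult)
    ultimately have "summable (\<lambda>l. norm (complex_of_real (C j / real l ^ 2)))"
      by (simp only:)
    hence "(\<lambda>l. complex_of_real (C j / real l ^ 2)) summable_on UNIV"
      by (rule norm_summable_imp_summable_on)
    thus ?thesis by (rule summable_on_subset_banach) auto
  qed
  hence "((\<lambda>l. \<Prod>j=1..n. complex_of_real (C j / real (l j) ^ 2)) has_sum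
      (\<Prod>j=1..n. \<Sum>\<^sub>\<infinity>l\<in>{0<..}. complex_of_real (C j / real l ^ 2))) (mL_indices n)"
    unfolding mL_indices_def by (intro has_sum_prod_PiE has_sum_infsum) auto
  hence "(\<lambda>l. complex_of_real (\<Prod>j=1..n. C j / real (l j) ^ 2)) summable_on mL_indices n"
    by (simp add: has_sum_imp_summable)
  hence sm: "(\<lambda>l. norm (complex_of_real (\<Prod>j=1..n. C j / real (l j) ^ 2))) summable_on mL_indices n"
    by (simp only: summable_on_iff_abs_summable_on_complex)
  have "Infinite_Sum.abs_summable_on (mL_term n f s) (mL_indices n)"
  proof (rule Infinite_Sum.abs_summable_on_comparison_test[OF sm])
    fix l assume l: "l \<in> mL_indices n"
    define L where "L = (\<lambda>j. \<Sum>i=j..n. l i)"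
    have L: "L j > 0" if "j \<in> {1..n}" for j
      using mL_indices_tail_ge[OF that, of l] mL_indices_pos[OF l that] by (simp add: L_def)
    have nL: "norm (complex_of_nat (L j) powr s j) = real (L j) powr Re (s j)" for j
      by (subst norm_powr_real_powr) auto
    have ins: "{1..n} = insert 1 {2..n}" using n by auto
    have "(\<Prod>j=1..n. real (l j) ^ K) \<le> (\<Prod>j=1..n. real (L 1) ^ K)"
    proof (intro prod_mono conjI power_mono)
      fix j assume "j \<in> {1..n}"
      hence "l j \<le> L 1" unfolding L_def by (intro member_le_sum) auto
      thus "real (l j) \<le> real (L 1)" by simp
    qed auto
    also have "\<dots> = real (L 1) powr real (n * K)"
      using L[of 1] n by (subst powr_realpow) (auto simp: power_mult mult.commute[of n])
    also have "\<dots> \<le> real (L 1) powr Re (s 1)"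
      using L[of 1] n s(2) by (intro powr_mono) (auto simp: K_def)
    also have "\<dots> \<le> real (L 1) powr Re (s 1) * (\<Prod>j=2..n. real (L j) powr Re (s j))"
    proof -
      have "1 \<le> (\<Prod>j=2..n. real (L j) powr Re (s j))"
      proof (rule prod_ge_1)
        fix j assume j: "j \<in> {2..n}"
        hence "L j > 0" by (intro L) auto
        thus "1 \<le> real (L j) powr Re (s j)" using s(1)[OF j] by (intro ge_one_powr_ge_zero) auto
      qed
      thus ?thesis using mult_left_mono[of 1 "\<Prod>j=2..n. real (L j) powr Re (s j)" "real (L 1) powr Re (s 1)"] by simp
    qed
    also have "\<dots> = norm (\<Prod>j=1..n. complex_of_nat (L j) powr s j)"
      unfolding ins prod_norm [symmetric] nL by simp
    finally have le: "(\<Prod>j=1..n. real (l j) ^ K) \<le> norm (\<Prod>j=1..n. complex_of_nat (L j) powr s j)" .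
    have pos: "(\<Prod>j=1..n. real (l j) ^ K) > 0" using mL_indices_pos[OF l] by (intro prod_pos) auto
    have "norm (mL_term n f s l) = (\<Prod>j=1..n. norm (fourier_coeff (f j) (l j))) / norm (\<Prod>j=1..n. complex_of_nat (L j) powr s j)"
      by (simp add: mL_term_def L_def norm_divide prod_norm)
    also have "\<dots> \<le> (\<Prod>j=1..n. norm (fourier_coeff (f j) (l j))) / (\<Prod>j=1..n. real (l j) ^ K)"
      by (intro divide_left_mono mult_pos_pos prod_nonneg less_le_trans[OF pos le] pos le) auto
    also have "\<dots> = (\<Prod>j=1..n. norm (fourier_coeff (f j) (l j)) / real (l j) ^ K)"
      by (rule prod_dividef [symmetric])
    also have "\<dots> \<le> (\<Prod>j=1..n. C j / real (l j) ^ 2)"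
      using C2 mL_indices_pos[OF l] by (intro prod_mono) auto
    also have "\<dots> \<le> norm (complex_of_real (\<Prod>j=1..n. C j / real (l j) ^ 2))"
      unfolding norm_of_real by (rule abs_ge_self)
    finally show "norm (mL_term n f s l) \<le> norm (complex_of_real (\<Prod>j=1..n. C j / real (l j) ^ 2))" .
  qed
  thus ?thesis by (simp only: summable_on_iff_abs_summable_on_complex)
qed

text \<open>Both branches of the definition of \<open>mL\<close> give the integral: where the series diverges, the
  integral provides the entire function in \<open>s 1\<close>, unique by the identity theorem.\<close>

lemma mLstar_eq_integral:
  assumes n: "n \<ge> 1" and f: "\<And>j. j \<in> {1..n} \<Longrightarrow> cusp_form (k j) (f j)"
    and s: "\<And>j. j \<in> {1..n} \<Longrightarrow> Re (s j) \<ge> 1"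
  shows "mLstar n f s = (\<integral>t. gap_integrand n f s t \<partial>Pi\<^sub>M {1..n} (\<lambda>_. lborel))"
proof -
  define E where "E = (\<lambda>z. \<integral>t. gap_integrand n f (s(1 := z)) t \<partial>Pi\<^sub>M {1..n} (\<lambda>_. lborel))"
  have spos: "Re ((s(1 := z)) j) > 0" if "j \<in> {1..n}" "Re z > 0" for j z
    using s[OF that(1)] that(2) by auto
  have s1: "Re (s 1) > 0" using s[of 1] n by auto
  have Gf: "Gamma_factor n (s(1 := z)) \<noteq> 0" if "Re z > 0" for z
    using spos that by (intro Gamma_factor_nonzero)
  have "mL n f s = E (s 1) / Gamma_factor n s"
  proof (cases "mL_term n f s summable_on mL_indices n")
    case True
    have "(mL_term n f s has_sum E (s 1) / Gamma_factor n s) (mL_indices n)"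
      unfolding E_def fun_upd_triv using spos[of _ "s 1"] s1 True
      by (intro has_sum_mL_term[OF n f]) auto
    with True show ?thesis by (simp add: mL_def infsumI)
  next
    case False
    \<comment> \<open>Division by the Gamma factor is expressed through \<open>rGamma\<close>, which
      is entire, so \<open>g\<close> is holomorphic also where Gamma has poles.\<close>
    define g where "g = (\<lambda>z. E z * (of_real (2 * pi) powr (\<Sum>j=1..n. (s(1 := z)) j) * (\<Prod>j=1..n. rGamma ((s(1 := z)) j))))"
    define \<sigma> where "\<sigma> = real (n * (2 + (\<Sum>j=1..n. k j)))"
    have g_eq: "g z = E z / Gamma_factor n (s(1 := z))" for z
      by (simp add: g_def Gamma_factor_def rGamma_inverse_Gamma divide_inverse prod_inversef [symmetric] del: fun_upd_apply)
    have "(\<lambda>z. (s(1 := z)) j) holomorphic_on UNIV" for j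
      by (cases "j = 1") (auto intro: holomorphic_intros)
    moreover have "E holomorphic_on UNIV"
      unfolding E_def using s by (intro holomorphic_gap_integral[OF n f]) auto
    ultimately have hol: "g holomorphic_on UNIV"
      unfolding g_def by (intro holomorphic_intros holomorphic_rGamma')
    have hs: "(mL_term n f (s(1 := z)) has_sum g z) (mL_indices n)" if z: "Re z > \<sigma>" for z
    proof -
      have "\<sigma> \<ge> 0" unfolding \<sigma>_def by (rule of_nat_0_le_iff)
      with z have z0: "Re z > 0" by linarith
      have "mL_term n f (s(1 := z)) summable_on mL_indices n"
        using z by (intro summable_mL_term[OF n f]) (auto simp: \<sigma>_def intro: order.trans[OF _ s])
      thus ?thesis unfolding g_eq E_def using spos z0 by (intro has_sum_mL_term[OF n f])
    qed
    have "(THE h. h holomorphic_on UNIV \<and> (\<exists>\<sigma>::real. \<forall>z. Re z > \<sigma> \<longrightarrow>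
        (mL_term n f (s(1 := z)) has_sum h z) (mL_indices n))) = g"
    proof (rule the_equality)
      show "g holomorphic_on UNIV \<and> (\<exists>\<sigma>::real. \<forall>z. Re z > \<sigma> \<longrightarrow>
        (mL_term n f (s(1 := z)) has_sum g z) (mL_indices n))"
        using hol hs by blast
      fix h assume "h holomorphic_on UNIV \<and> (\<exists>\<sigma>::real. \<forall>z. Re z > \<sigma> \<longrightarrow>
        (mL_term n f (s(1 := z)) has_sum h z) (mL_indices n))"
      then obtain \<tau> :: real where h: "h holomorphic_on UNIV"
        "\<And>z. Re z > \<tau> \<Longrightarrow> (mL_term n f (s(1 := z)) has_sum h z) (mL_indices n)" by blast
      show "h = g"
      proof
        fix z
        show "h z = g z"
        proof (rule analytic_continuation_open[of "{z. Re z > max \<sigma> \<tau>}" UNIV h g])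
          have "complex_of_real (max \<sigma> \<tau> + 1) \<in> {z. Re z > max \<sigma> \<tau>}"
            unfolding mem_Collect_eq Re_complex_of_real by linarith
          thus "{z. Re z > max \<sigma> \<tau>} \<noteq> {}" by blast
          show "h z = g z" if "z \<in> {z. Re z > max \<sigma> \<tau>}" for z
            using hs[of z] h(2)[of z] that by (intro has_sum_unique) auto
          show "open {z. Re z > max \<sigma> \<tau>}" by (rule open_halfspace_Re_gt)
        qed (use hol h in auto)
      qed
    qed
    with False have "mL n f s = g (s 1)" by (simp add: mL_def)
    also have "\<dots> = E (s 1) / Gamma_factor n s" unfolding g_eq fun_upd_triv ..
    finally show ?thesis .
  qed
  thus ?thesis
    using Gf[OF s1] unfolding mLstar_def Gamma_factor_def [symmetric] by (simp add: E_def)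
qed

section \<open>The two relations at positive integer exponents\<close>

lemma powr_nat_minus_one:
  assumes "x > 0" "m > 0"
  shows "complex_of_real x powr (of_nat m - 1) = of_real x ^ (m - 1)"
proof -
  have "of_nat m - 1 = (of_nat (m - 1) :: complex)" using assms(2) by (simp add: of_nat_diff)
  thus ?thesis using assms(1) by (simp only: powr_nat) simp
qed

lemma gap_of_real: "gap (\<lambda>j. complex_of_real (t j)) i = of_real (gap t i)"
  by (simp add: gap_def)

lemma mLambda_eq_integral:
  "mLambda n f s = (\<integral>t. indicator (ordered_region n) t *\<^sub>R mLambda_integrand n f s t \<partial>Pi\<^sub>M {1..n} (\<lambda>_. lborel))"
  by (simp add: mLambda_def set_lebesgue_integral_def)

lemma tuples_same_sum_pos: "M \<in> tuples_same_sum n m \<Longrightarrow> j \<in> {1..n} \<Longrightarrow> M j > 0"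
  by (auto simp: tuples_same_sum_def PiE_iff Suc_le_eq One_nat_def)

lemma mLambda_eq_sum_mLstar:
  assumes n: "n \<ge> 1" and f: "\<And>j. j \<in> {1..n} \<Longrightarrow> cusp_form (k j) (f j)"
    and m: "\<And>j. j \<in> {1..n} \<Longrightarrow> m j > 0"
  shows "mLambda n f (\<lambda>j. of_nat (m j)) =
     (\<Sum>M\<in>tuples_same_sum n m. coeff_A n m M * mLstar n f (\<lambda>j. of_nat (M j)))"
proof -
  have "indicator (ordered_region n) t *\<^sub>R mLambda_integrand n f (\<lambda>j. of_nat (m j)) t =
      (\<Sum>M\<in>tuples_same_sum n m. coeff_A n m M * gap_integrand n f (\<lambda>j. of_nat (M j)) t)"
    if t: "t \<in> space (Pi\<^sub>M {1..n} (\<lambda>_. lborel))" for t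
  proof (cases "pos_gaps n t")
    case True
    have "(\<Prod>j=1..n. complex_of_real (t j) powr (of_nat (m j) - 1)) =
        (\<Prod>b=1..n. (\<Sum>a=1..b. of_real (gap t a)) ^ (m b - 1))"
    proof (intro prod.cong refl)
      fix b assume b: "b \<in> {1..n}"
      have "(\<Sum>a=1..b. complex_of_real (gap t a)) = of_real (t b)"
        using sum_gap[of t b] b by (simp flip: of_real_sum)
      thus "complex_of_real (t b) powr (of_nat (m b) - 1) = (\<Sum>a=1..b. of_real (gap t a)) ^ (m b - 1)"
        using powr_nat_minus_one[OF pos_gaps_pos(1)[OF True b] m[OF b]] by simp
    qed
    also have "\<dots> = (\<Sum>M\<in>tuples_same_sum n m. coeff_A n m M * (\<Prod>j=1..n. of_real (gap t j) ^ (M j - 1)))"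
      using m by (rule prod_partial_sums_power)
    also have "\<dots> = (\<Sum>M\<in>tuples_same_sum n m. coeff_A n m M * (\<Prod>j=1..n. complex_of_real (gap t j) powr (of_nat (M j) - 1)))"
      using powr_nat_minus_one[OF pos_gaps_pos(2)[OF True] tuples_same_sum_pos]
      by (intro sum.cong prod.cong arg_cong2[of _ _ _ _ "(*)"] refl) simp
    finally show ?thesis
      using True by (simp add: Lambda_integrand_region[OF t] gap_integrand_def sum_distrib_left mult_ac)
  qed (simp add: Lambda_integrand_region[OF t] gap_integrand_def)
  hence "mLambda n f (\<lambda>j. of_nat (m j)) = (\<integral>t. (\<Sum>M\<in>tuples_same_sum n m.
      coeff_A n m M * gap_integrand n f (\<lambda>j. of_nat (M j)) t) \<partial>Pi\<^sub>M {1..n} (\<lambda>_. lborel))"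
    unfolding mLambda_eq_integral by (intro Bochner_Integration.integral_cong refl)
  also have "\<dots> = (\<Sum>M\<in>tuples_same_sum n m. coeff_A n m M *
      (\<integral>t. gap_integrand n f (\<lambda>j. of_nat (M j)) t \<partial>Pi\<^sub>M {1..n} (\<lambda>_. lborel)))"
  proof (subst Bochner_Integration.integral_sum)
    fix M assume M: "M \<in> tuples_same_sum n m"
    show "integrable (Pi\<^sub>M {1..n} (\<lambda>_. lborel)) (\<lambda>t. coeff_A n m M * gap_integrand n f (\<lambda>j. of_nat (M j)) t)"
    proof (intro integrable_mult_right integrable_gap_integrand[OF f])
      fix j assume "j \<in> {2..n}"
      hence "M j > 0" by (intro tuples_same_sum_pos[OF M]) auto
      thus "1 \<le> Re (of_nat (M j))" by simp
    qed
  qed simp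
  \<comment> \<open>All entries of \<open>M\<close> are at least 1, so the integral formula applies
    to each summand, whether its series converges or is continued.\<close>
  also have "\<dots> = (\<Sum>M\<in>tuples_same_sum n m. coeff_A n m M * mLstar n f (\<lambda>j. of_nat (M j)))"
  proof (intro sum.cong refl arg_cong2[of _ _ _ _ "(*)"] mLstar_eq_integral[OF n f, symmetric])
    fix M j assume "M \<in> tuples_same_sum n m" "j \<in> {1..n}"
    from tuples_same_sum_pos[OF this] show "1 \<le> Re (of_nat (M j))" by simp
  qed
  finally show ?thesis .
qed

lemma mLstar_eq_sum_mLambda:
  assumes n: "n \<ge> 1" and f: "\<And>j. j \<in> {1..n} \<Longrightarrow> cusp_form (k j) (f j)"
    and m: "\<And>j. j \<in> {1..n} \<Longrightarrow> m j > 0"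
  shows "mLstar n f (\<lambda>j. of_nat (m j)) =
     (\<Sum>M\<in>tuples_same_sum n m. coeff_B n m M * mLambda n f (\<lambda>j. of_nat (M j)))"
proof -
  define \<Lambda> where "\<Lambda> = (\<lambda>M t. indicator (ordered_region n) t *\<^sub>R mLambda_integrand n f (\<lambda>j. of_nat (M j)) t)"
  have "gap_integrand n f (\<lambda>j. of_nat (m j)) t = (\<Sum>M\<in>tuples_same_sum n m. coeff_B n m M * \<Lambda> M t)"
    if t: "t \<in> space (Pi\<^sub>M {1..n} (\<lambda>_. lborel))" for t
  proof (cases "pos_gaps n t")
    case True
    have "(\<Prod>j=1..n. complex_of_real (gap t j) powr (of_nat (m j) - 1)) =
        (\<Prod>j=1..n. gap (\<lambda>j. complex_of_real (t j)) j ^ (m j - 1))"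
      unfolding gap_of_real using powr_nat_minus_one[OF pos_gaps_pos(2)[OF True] m]
      by (intro prod.cong refl)
    also have "\<dots> = (\<Sum>M\<in>tuples_same_sum n m. coeff_B n m M * (\<Prod>j=1..n. of_real (t j) ^ (M j - 1)))"
      using m n by (rule prod_gap_power)
    also have "\<dots> = (\<Sum>M\<in>tuples_same_sum n m. coeff_B n m M * (\<Prod>j=1..n. complex_of_real (t j) powr (of_nat (M j) - 1)))"
      using powr_nat_minus_one[OF pos_gaps_pos(1)[OF True] tuples_same_sum_pos]
      by (intro sum.cong prod.cong arg_cong2[of _ _ _ _ "(*)"] refl) simp
    finally show ?thesis
      using True by (simp add: \<Lambda>_def Lambda_integrand_region[OF t] gap_integrand_def sum_distrib_left mult_ac)
  qed (simp add: \<Lambda>_def Lambda_integrand_region[OF t] gap_integrand_def)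
  hence "(\<integral>t. gap_integrand n f (\<lambda>j. of_nat (m j)) t \<partial>Pi\<^sub>M {1..n} (\<lambda>_. lborel)) =
      (\<integral>t. (\<Sum>M\<in>tuples_same_sum n m. coeff_B n m M * \<Lambda> M t) \<partial>Pi\<^sub>M {1..n} (\<lambda>_. lborel))"
    by (intro Bochner_Integration.integral_cong refl)
  \<comment> \<open>The signed terms may be integrated one by one: each monomial in the
    \<open>t j\<close> is integrable by itself against the decaying forms.\<close>
  also have "\<dots> = (\<Sum>M\<in>tuples_same_sum n m. coeff_B n m M * (\<integral>t. \<Lambda> M t \<partial>Pi\<^sub>M {1..n} (\<lambda>_. lborel)))"
  proof (subst Bochner_Integration.integral_sum)
    fix M
    show "integrable (Pi\<^sub>M {1..n} (\<lambda>_. lborel)) (\<lambda>t. coeff_B n m M * \<Lambda> M t)"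
      unfolding \<Lambda>_def
      by (intro integrable_mult_right integrable_Lambda_integrand[OF f, unfolded set_integrable_def])
  qed simp
  also have "\<dots> = (\<Sum>M\<in>tuples_same_sum n m. coeff_B n m M * mLambda n f (\<lambda>j. of_nat (M j)))"
    by (simp add: \<Lambda>_def mLambda_eq_integral)
  finally have "(\<integral>t. gap_integrand n f (\<lambda>j. of_nat (m j)) t \<partial>Pi\<^sub>M {1..n} (\<lambda>_. lborel)) =
      (\<Sum>M\<in>tuples_same_sum n m. coeff_B n m M * mLambda n f (\<lambda>j. of_nat (M j)))" .
  moreover have "mLstar n f (\<lambda>j. of_nat (m j)) =
      (\<integral>t. gap_integrand n f (\<lambda>j. of_nat (m j)) t \<partial>Pi\<^sub>M {1..n} (\<lambda>_. lborel))"
  proof (rule mLstar_eq_integral[of n k f])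
    show "1 \<le> Re (of_nat (m j))" if "j \<in> {1..n}" for j
      using m[OF that] by simp
  qed (fact n f)+
  ultimately show ?thesis by simp
qed

theorem proposition2p4:
  fixes n :: nat and k m :: "nat \<Rightarrow> nat" and f :: "nat \<Rightarrow> complex \<Rightarrow> complex"
  assumes "n \<ge> 1"
    and "\<And>j. j \<in> {1..n} \<Longrightarrow> cusp_form (k j) (f j)"
    and "\<And>j l. j \<in> {1..n} \<Longrightarrow> fourier_coeff (f j) l \<in> \<rat>"
    and "admissible n k m"
  shows
    "mLambda n f (\<lambda>j. of_nat (m j)) =
       (\<Sum>M\<in>tuples_same_sum n m. coeff_A n m M * mLstar n f (\<lambda>j. of_nat (M j))) \<and>
     mLstar n f (\<lambda>j. of_nat (m j)) =
       (\<Sum>M\<in>tuples_same_sum n m. coeff_B n m M * mLambda n f (\<lambda>j. of_nat (M j))) \<and>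
     (\<exists>E :: (nat \<Rightarrow> nat) \<Rightarrow> complex.
        (\<forall>p. admissible n k p \<longrightarrow> E p = mLstar n f (\<lambda>j. of_nat (p j))) \<and>
        (\<forall>p. (\<forall>M\<in>tuples_same_sum n p.
                set_integrable (Pi\<^sub>M {1..n} (\<lambda>_. lborel)) (ordered_region n)
                  (mLambda_integrand n f (\<lambda>j. of_nat (M j)))) \<and>
             E p = (\<Sum>M\<in>tuples_same_sum n p. coeff_B n p M * mLambda n f (\<lambda>j. of_nat (M j)))))"
proof (intro conjI)
  note n = assms(1) and f = assms(2)
  have pos: "p j > 0" if "admissible n k p" "j \<in> {1..n}" for p j
    using that by (simp add: admissible_def)
  show "mLambda n f (\<lambda>j. of_nat (m j)) =
       (\<Sum>M\<in>tuples_same_sum n m. coeff_A n m M * mLstar n f (\<lambda>j. of_nat (M j)))"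
    by (intro mLambda_eq_sum_mLstar[of n k f] n f pos[OF assms(4)])
  have B: "mLstar n f (\<lambda>j. of_nat (p j)) =
       (\<Sum>M\<in>tuples_same_sum n p. coeff_B n p M * mLambda n f (\<lambda>j. of_nat (M j)))"
    if "admissible n k p" for p
    by (intro mLstar_eq_sum_mLambda[of n k f] n f pos[OF that])
  show "mLstar n f (\<lambda>j. of_nat (m j)) =
       (\<Sum>M\<in>tuples_same_sum n m. coeff_B n m M * mLambda n f (\<lambda>j. of_nat (M j)))"
    by (rule B[OF assms(4)])
  show "\<exists>E :: (nat \<Rightarrow> nat) \<Rightarrow> complex.
        (\<forall>p. admissible n k p \<longrightarrow> E p = mLstar n f (\<lambda>j. of_nat (p j))) \<and>
        (\<forall>p. (\<forall>M\<in>tuples_same_sum n p.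
                set_integrable (Pi\<^sub>M {1..n} (\<lambda>_. lborel)) (ordered_region n)
                  (mLambda_integrand n f (\<lambda>j. of_nat (M j)))) \<and>
             E p = (\<Sum>M\<in>tuples_same_sum n p. coeff_B n p M * mLambda n f (\<lambda>j. of_nat (M j))))"
    \<comment> \<open>The extension is the right-hand side of the second relation, meaningful at
      every tuple because all the \<open>mLambda\<close> integrals converge absolutely; on
      admissible tuples it equals \<open>mLstar\<close> by \<open>B\<close>.\<close>
    using B integrable_Lambda_integrand[OF f]
    by (intro exI[of _ "\<lambda>p. \<Sum>M\<in>tuples_same_sum n p. coeff_B n p M * mLambda n f (\<lambda>j. of_nat (M j))"]) simp
qed

end
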